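(* Let $m>n>1$ be integers, let $D\subseteq\{0,\dots,m-1\}\times\{0,\dots,n-1\}$, and let $F$ be the Bedford-McMullen carpet with exponents $m,n$ and allowed digit set $D$. Suppose that there exists $i_0\in\{0,\dots,m-1\}$ such that $$\{j\in\{0,\dots,n-1\}:\ (i_0,j)\in D\}=\{0,\dots,n-1\}.$$ Then there exists $r=r(F)>0$ such that for every $u\in B(0,r)=(-r,r)$ there is some $t\in\mathbb{R}$ with $$\dim^*(\ell_{u,t}\cap F)=\dim^* F-1.$$
   Context: Bedford-McMullen carpet: for integers $m>n>1$ and $D\subseteq\{0,\dots,m-1\}\times\{0,\dots,n-1\}$, the carpet with exponents $m,n$ and allowed digit set $D$ is $$F=\left\{\left(\sum_{k=1}^\infty\frac{x_k}{m^k},\ \sum_{k=1}^\infty\frac{y_k}{n^k}\right):\ (x_k,y_k)\in D\text{ for all }k\right\}\subseteq[0,1]^2.$$ Lines: for $(u,t)\in\mathbb{R}\times\mathbb{R}$, $\ell_{u,t}=\{(x,y)\in\mathbb{R}^2: y=ux+t\}$ is the planar line with slope $u$ that intersects the $y$-axis at $t$. Star dimension: let $X\subseteq[0,1]^2$ be compact. A non-empty closed set $A\subseteq[-1,1]^2$ is a miniset of $X$ if $A\subseteq(a\cdot X+v)\cap[-1,1]^2$ for some real $a\ge1$ and some $v\in\mathbb{R}^2$. A set $M$ is a microset of $X$ if $M$ is a limit, in the Hausdorff metric on non-empty closed subsets of $[-1,1]^2$, of a sequence of minisets of $X$. The star dimension of $X$ is $$\dim^*X=\sup\{\dim_H M:\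 M\text{ is a microset of }X\},$$ where $\dim_H$ is Hausdorff dimension. *)

theory Defs
  imports "HOL-Analysis.Analysis"
begin

subsection \<open>Hausdorff dimension\<close>

text \<open>
  Gauge of one covering set, with the conventions that the empty set contributes \<open>0\<close> and that
  \<open>0\<^sup>0 = 1\<close> (note that \<open>0 powr 0 = 0\<close>), so that the case \<open>s = 0\<close> is counting measure.
\<close>

definition diam_gauge :: "real \<Rightarrow> 'a::metric_space set \<Rightarrow> ennreal" where
  "diam_gauge s U =
     (if U = {} then 0 else if s = 0 then 1 else ennreal (diameter U powr s))"

text \<open>
  Boundedness is required of the covering sets because \<^const>\<open>diameter\<close> is real-valued and
  unspecified on unbounded sets. Finite covers are included by padding with empty sets.
\<close>

definition hausdorff_premeasure :: "real \<Rightarrow> real \<Rightarrow> 'a::metric_space set \<Rightarrow> ennreal" where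
  "hausdorff_premeasure s \<delta> E =
     Inf {(\<Sum>i. diam_gauge s (U i)) | U :: nat \<Rightarrow> 'a set.
            E \<subseteq> (\<Union>i. U i) \<and> (\<forall>i. bounded (U i) \<and> diameter (U i) \<le> \<delta>)}"

definition hausdorff_outer_measure :: "real \<Rightarrow> 'a::metric_space set \<Rightarrow> ennreal" where
  "hausdorff_outer_measure s E = (SUP \<delta>\<in>{0<..}. hausdorff_premeasure s \<delta> E)"

definition hausdorff_dim :: "'a::metric_space set \<Rightarrow> ereal" where
  "hausdorff_dim E = Inf {ereal s | s. 0 \<le> s \<and> hausdorff_outer_measure s E = 0}"

subsection \<open>Hausdorff metric, minisets, microsets and star dimension\<close>

text \<open>Meaningful for non-empty bounded sets; a metric on the non-empty compact ones.\<close>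

definition hausdorff_dist :: "'a::metric_space set \<Rightarrow> 'a set \<Rightarrow> real" where
  "hausdorff_dist A B = max (SUP a\<in>A. infdist a B) (SUP b\<in>B. infdist b A)"

definition unit_window :: "(real \<times> real) set" where
  "unit_window = {-1..1} \<times> {-1..1}"

definition miniset :: "(real \<times> real) set \<Rightarrow> (real \<times> real) set \<Rightarrow> bool" where
  "miniset X A \<longleftrightarrow> A \<noteq> {} \<and> closed A \<and>
     (\<exists>(a::real) v. a \<ge> 1 \<and> A \<subseteq> (\<lambda>p. a *\<^sub>R p + v) ` X \<inter> unit_window)"

definition microset :: "(real \<times> real) set \<Rightarrow> (real \<times> real) set \<Rightarrow> bool" where
  "microset X M \<longleftrightarrow> M \<noteq> {} \<and> closed M \<and> M \<subseteq> unit_window \<and>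
     (\<exists>A. (\<forall>k::nat. miniset X (A k)) \<and> (\<lambda>k. hausdorff_dist (A k) M) \<longlonglongrightarrow> 0)"

text \<open>
  The supremum is taken in the extended reals, so \<open>star_dim {} = -\<infinity>\<close>, whereas
  \<open>star_dim X \<ge> 0\<close> for every non-empty compact \<open>X\<close>: an empty set never has the star dimension
  of a non-empty one.
\<close>

definition star_dim :: "(real \<times> real) set \<Rightarrow> ereal" where
  "star_dim X = Sup {hausdorff_dim M | M. microset X M}"

subsection \<open>Bedford-McMullen carpets and planar lines\<close>

text \<open>Digit sequences are indexed from \<open>1\<close>; their value at \<open>0\<close> is irrelevant.\<close>

definition carpet :: "nat \<Rightarrow> nat \<Rightarrow> (nat \<times> nat) set \<Rightarrow> (real \<times> real) set" where
  "carpet m n D =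
     {(\<Sum>k. real (x (Suc k)) / real m ^ Suc k, \<Sum>k. real (y (Suc k)) / real n ^ Suc k) | x y.
        \<forall>k\<ge>1. (x k, y k) \<in> D}"

definition planar_line :: "real \<Rightarrow> real \<Rightarrow> (real \<times> real) set" where
  "planar_line u t = {(x, y). y = u * x + t}"

end

theory Submission
  imports Defs
begin

text \<open>
  Let \<open>N\<close> be the size of a largest row \<open>j\<^sub>0\<close> of \<open>D\<close> and put \<open>s = log\<^bsub>m\<^esub> N\<close>. The star
  dimension of the carpet is \<open>1 + s\<close>, so the task is to find, for every slope of absolute value at
  most \<open>1\<close>, an intercept whose slice has star dimension \<open>s\<close>.

  The geometry rests on the disparity \<open>m > n\<close>: a length \<open>m\<^bsup>-k\<^esup>\<close> corresponds to \<open>k\<close> horizontal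
  digits, but to a number of vertical digits that exceeds \<open>k\<close> by an amount tending to infinity.
  Hence, for a long range of further depths \<open>q\<close>, the vertical digits seen in a window of
  size \<open>m\<^bsup>-k\<^esup>\<close> are prescribed, and at most \<open>N\<^bsup>q\<^esup>\<close>
  horizontal words of length \<open>q\<close> are compatible with them (\<open>local_codes\<close>). A microset obtained by
  unbounded magnification therefore projects to a set covered by \<open>O(N\<^bsup>q\<^esup>)\<close> intervals of length
  \<open>m\<^bsup>-q\<^esup>\<close> for every \<open>q\<close>. In the carpet each of these intervals carries a vertical segment, which
  contributes one more dimension; on a line it carries a single small piece, which contributes
  none. Microsets obtained by bounded magnification are controlled by covers of the set itself.
  This gives both upper bounds (\<open>star_dim_le_of_cells\<close>, \<open>star_dim_carpet_le\<close>,
  \<open>star_dim_slice_le\<close>), for the slice under the condition that for infinitely many \<open>k\<close> the line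
  meets at most \<open>(k + 1) N\<^bsup>k\<^esup>\<close> of the rectangles of level \<open>k\<close>.

  For the lower bounds, a horizontal expansion that continues with \<open>i\<^sub>0\<close> forever is compatible with
  all later vertical digits, because the column \<open>i\<^sub>0\<close> is full: above such an abscissa the carpet
  contains the vertical segment that crosses the rectangle reached from bottom to top.
  If the line passes, near the column point with horizontal digits all \<open>i\<^sub>0\<close>, well inside a strip
  of vertical digits \<open>\<dots> j\<^sub>0 \<dots> j\<^sub>0\<close> (\<open>q\<close> copies), then every horizontal word of
  length \<open>q\<close> over row \<open>j\<^sub>0\<close>, preceded and continued by digits \<open>i\<^sub>0\<close>, is the abscissa of a point of
  the slice.
  Magnifying and letting \<open>q\<close> grow, the graph over the self-similar set with digits in row \<open>j\<^sub>0\<close>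
  becomes a microset of the slice (\<open>microset_sheared\<close>, \<open>star_dim_slice_ge\<close>), and in the same way
  the product of this set with an interval becomes a microset of the carpet
  (\<open>star_dim_carpet_ge\<close>). Their dimensions are bounded below by mass distribution.

  It remains to choose the intercept so that both conditions hold (\<open>exists_height\<close>). There are at
  most \<open>(n N)\<^bsup>k\<^esup>\<close> rectangles of level \<open>k\<close>, and each is met for heights in an interval of
  length \<open>O(n\<^bsup>-k\<^esup>)\<close>, so on average over the height the line meets \<open>O(N\<^bsup>k\<^esup>)\<close> of them.
  Hence the heights that meet few rectangles at some late level form a dense set, which
  is open; so do the heights well inside a strip with \<open>q\<close> copies of \<open>j\<^sub>0\<close>. By Baire's theorem
  some height belongs to all of these sets.
\<close>

section \<open>Digit expansions\<close>

definition expansion :: "nat \<Rightarrow> (nat \<Rightarrow> nat) \<Rightarrow> real" where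
  "expansion b d = (\<Sum>k. real (d k) / real b ^ Suc k)"

text \<open>
  Encoding words of digits by integers turns statements about cylinders into inequalities between reals.
\<close>

primrec prefix_value :: "nat \<Rightarrow> (nat \<Rightarrow> nat) \<Rightarrow> nat \<Rightarrow> nat" where
  "prefix_value b d 0 = 0"
| "prefix_value b d (Suc k) = b * prefix_value b d k + d k"

lemma summable_expansion:
  assumes "1 < b" and "\<And>k. d k < b"
  shows "summable (\<lambda>k. real (d k) / real b ^ Suc k)"
proof (rule summable_comparison_test)
  show "\<exists>K. \<forall>k\<ge>K. norm (real (d k) / real b ^ Suc k) \<le> (1 / real b) ^ k"
  proof (intro exI allI impI)
    fix k
    have "real (d k) \<le> real b" using assms(2)[of k] by simp
    then show "norm (real (d k) / real b ^ Suc k) \<le> (1 / real b) ^ k"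
      using assms(1) by (simp add: field_simps power_divide)
  qed
  show "summable (\<lambda>k. (1 / real b) ^ k)" using assms(1) by (intro summable_geometric) auto
qed

lemma expansion_nonneg: "1 < b \<Longrightarrow> (\<And>k. d k < b) \<Longrightarrow> 0 \<le> expansion b d"
  unfolding expansion_def by (intro suminf_nonneg summable_expansion) auto

lemma expansion_le_1:
  assumes "1 < b" and "\<And>k. d k < b"
  shows "expansion b d \<le> 1"
proof -
  have "(\<lambda>k. (1 / real b) ^ k) sums (1 / (1 - 1 / real b))"
    using assms(1) by (intro geometric_sums) auto
  from sums_mult[OF this, of "(real b - 1) / real b"]
  have s: "(\<lambda>k. (real b - 1) / real b * (1 / real b) ^ k) sums 1"
    using assms(1) by (simp add: field_simps)
  have "expansion b d \<le> (\<Sum>k. (real b - 1) / real b * (1 / real b) ^ k)"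
    unfolding expansion_def
  proof (rule suminf_le)
    fix k
    have "real (d k) \<le> real b - 1" using assms(2)[of k] by linarith
    then show "real (d k) / real b ^ Suc k \<le> (real b - 1) / real b * (1 / real b) ^ k"
      using assms(1) by (simp add: field_simps power_divide)
  qed (use summable_expansion[of b d] assms s sums_summable in auto)
  with s show ?thesis by (simp add: sums_unique[symmetric])
qed

lemma expansion_head:
  assumes "1 < b" and "\<And>k. d k < b"
  shows "expansion b d = (real (d 0) + expansion b (\<lambda>i. d (Suc i))) / real b"
proof -
  have "expansion b d
      = real (d 0) / real b + (\<Sum>k. real (d (Suc k)) / real b ^ Suc (Suc k))"
    unfolding expansion_def using suminf_split_head[OF summable_expansion[of b d]] assms by simp
  also have "(\<Sum>k. real (d (Suc k)) / real b ^ Suc (Suc k))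
      = (\<Sum>k. real (d (Suc k)) / real b ^ Suc k / real b)"
    by (simp add: field_simps)
  also have "\<dots> = expansion b (\<lambda>i. d (Suc i)) / real b"
    unfolding expansion_def
    using suminf_divide[OF summable_expansion[of b "\<lambda>i. d (Suc i)"], of "real b"] assms by blast
  finally show ?thesis by (simp add: add_divide_distrib)
qed

lemma expansion_prefix:
  assumes "1 < b" and "\<And>k. d k < b"
  shows "real b ^ k * expansion b d = real (prefix_value b d k) + expansion b (\<lambda>i. d (k + i))"
proof (induction k)
  case (Suc k)
  have "real b * expansion b (\<lambda>i. d (k + i)) = real (d k) + expansion b (\<lambda>i. d (Suc k + i))"
    using expansion_head[of b "\<lambda>i. d (k + i)"] assms by simp
  with Suc show ?case by (simp add: algebra_simps)
qed simp

lemma expansion_bounds: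
  assumes "1 < b" and "\<And>k. d k < b"
  shows "real (prefix_value b d k) \<le> real b ^ k * expansion b d"
    and "real b ^ k * expansion b d \<le> real (prefix_value b d k) + 1"
  using expansion_prefix[OF assms, of k] expansion_nonneg[of b "\<lambda>i. d (k + i)"]
    expansion_le_1[of b "\<lambda>i. d (k + i)"] assms by auto

lemma prefix_value_cong:
  "(\<And>i. i < k \<Longrightarrow> d i = e i) \<Longrightarrow> prefix_value b d k = prefix_value b e k"
  by (induction k) auto

lemma prefix_value_less: "(\<And>i. d i < b) \<Longrightarrow> prefix_value b d k < b ^ k"
proof (induction k)
  case (Suc k)
  then have "prefix_value b d k + 1 \<le> b ^ k" by simp
  then have "b * (prefix_value b d k + 1) \<le> b * b ^ k" by (rule mult_le_mono2)
  then show ?case using Suc.prems[of k] by simp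
qed simp

lemma prefix_value_append:
  "prefix_value b d (k + q) = prefix_value b d k * b ^ q + prefix_value b (\<lambda>i. d (k + i)) q"
  by (induction q) (auto simp: algebra_simps)

lemma prefix_value_inject:
  assumes "\<And>k. d k < b" and "\<And>k. e k < b" and "prefix_value b d k = prefix_value b e k"
    and "i < k"
  shows "d i = e i"
  using assms(3,4)
proof (induction k)
  case (Suc k)
  have "d k = (b * prefix_value b d k + d k) mod b" using assms(1)[of k] by simp
  also have "\<dots> = (b * prefix_value b e k + e k) mod b" using Suc.prems(1) by simp
  also have "\<dots> = e k" using assms(2)[of k] by simp
  finally have dk: "d k = e k" .
  moreover have "0 < b" using assms(1)[of 0] by simp
  ultimately have "prefix_value b d k = prefix_value b e k" using Suc.prems(1) by simp
  with Suc dk show ?case by (cases "i = k") auto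
qed simp

text \<open>
  Numbers within \<open>L\<close> units of the last place differ by at most \<open>L + 1\<close> in their prefixes: the
  extra unit is the tail, and it also absorbs the ambiguity of expansions at the end points.
\<close>

lemma prefix_value_close:
  assumes "1 < b" and "\<And>k. d k < b" and "\<And>k. e k < b"
    and "\<bar>expansion b d - expansion b e\<bar> \<le> real L / real b ^ k"
  shows "prefix_value b d k \<in> {prefix_value b e k - (L + 1)..prefix_value b e k + (L + 1)}"
proof -
  have "\<bar>real b ^ k * expansion b d - real b ^ k * expansion b e\<bar>
      = real b ^ k * \<bar>expansion b d - expansion b e\<bar>"
    by (simp add: abs_mult flip: right_diff_distrib)
  also have "\<dots> \<le> real b ^ k * (real L / real b ^ k)" using assms(4) by (intro mult_left_mono) auto
  also have "\<dots> = real L" using assms(1) by simp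
  finally have "\<bar>real b ^ k * expansion b d - real b ^ k * expansion b e\<bar> \<le> real L" .
  moreover have "real (prefix_value b d k) \<le> real b ^ k * expansion b d"
      "real b ^ k * expansion b d \<le> real (prefix_value b d k) + 1"
    using expansion_bounds[of b d k] assms(1,2) by blast+
  moreover have "real (prefix_value b e k) \<le> real b ^ k * expansion b e"
      "real b ^ k * expansion b e \<le> real (prefix_value b e k) + 1"
    using expansion_bounds[of b e k] assms(1,3) by blast+
  ultimately have "\<bar>real (prefix_value b d k) - real (prefix_value b e k)\<bar> \<le> real L + 1"
    by linarith
  then show ?thesis by auto
qed

lemma expansion_close_of_prefix:
  assumes "1 < b" and "\<And>i. d i < b" and "\<And>i. e i < b" and "\<And>i. i < k \<Longrightarrow> d i = e i"
  shows "\<bar>expansion b d - expansion b e\<bar> \<le> 1 / real b ^ k"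
proof -
  have eq: "prefix_value b d k = prefix_value b e k" using assms(4) by (rule prefix_value_cong)
  have "\<bar>real b ^ k * expansion b d - real b ^ k * expansion b e\<bar> \<le> 1"
    using expansion_bounds[of b d k] expansion_bounds[of b e k] assms(1,2,3) unfolding eq by fastforce
  then have "real b ^ k * \<bar>expansion b d - expansion b e\<bar> \<le> 1"
    by (simp add: abs_mult flip: right_diff_distrib)
  then show ?thesis using assms(1) by (simp add: field_simps)
qed

definition digit :: "nat \<Rightarrow> real \<Rightarrow> nat \<Rightarrow> nat" where
  "digit b z k = nat \<lfloor>real b ^ Suc k * z\<rfloor> mod b"

lemma digit_less: "0 < b \<Longrightarrow> digit b z k < b"
  by (simp add: digit_def)

lemma prefix_value_digit:
  assumes "0 < b" and "0 \<le> z" and "z < 1"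
  shows "prefix_value b (digit b z) k = nat \<lfloor>real b ^ k * z\<rfloor>"
proof (induction k)
  case 0
  then show ?case using assms by (simp add: floor_eq_iff)
next
  case (Suc k)
  have "\<lfloor>real b ^ k * z\<rfloor> = \<lfloor>(real b ^ Suc k * z) / real_of_int (int b)\<rfloor>"
    using assms by simp
  also have "\<dots> = \<lfloor>real b ^ Suc k * z\<rfloor> div int b"
    by (rule floor_divide_real_eq_div) simp
  finally have "nat \<lfloor>real b ^ k * z\<rfloor> = nat \<lfloor>real b ^ Suc k * z\<rfloor> div b"
    using assms by (simp add: nat_div_distrib)
  with Suc show ?case by (simp add: digit_def)
qed

lemma real_eq_of_scaled_dist:
  assumes "1 < b" and "\<And>k. \<bar>real b ^ k * x - real b ^ k * y\<bar> \<le> 1"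
  shows "x = y"
proof (rule ccontr)
  assume "x \<noteq> y"
  then have pos: "0 < \<bar>x - y\<bar>" by simp
  obtain k where "1 / \<bar>x - y\<bar> < real b ^ k"
    using real_arch_pow[of "real b" "1 / \<bar>x - y\<bar>"] assms(1) by auto
  then have "1 < real b ^ k * \<bar>x - y\<bar>" using pos by (simp add: field_simps)
  moreover have "real b ^ k * \<bar>x - y\<bar> = \<bar>real b ^ k * x - real b ^ k * y\<bar>"
    by (simp add: abs_mult flip: right_diff_distrib)
  ultimately show False using assms(2)[of k] by linarith
qed

lemma expansion_digit:
  assumes "1 < b" and "0 \<le> z" and "z < 1"
  shows "expansion b (digit b z) = z"
proof (rule real_eq_of_scaled_dist[OF assms(1)])
  fix k
  have d: "\<And>k. digit b z k < b" using assms(1) by (simp add: digit_less)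
  have "real (prefix_value b (digit b z) k) = real_of_int \<lfloor>real b ^ k * z\<rfloor>"
    using prefix_value_digit[of b z k] assms by simp
  then show "\<bar>real b ^ k * expansion b (digit b z) - real b ^ k * z\<bar> \<le> 1"
    using expansion_bounds[of b "digit b z" k] assms(1) d by simp linarith
qed

text \<open>
  Splicing three strings of digits: the word of \<open>U\<close>, the block \<open>j \<dots> j\<close>, and the digits of \<open>z\<close>.
  It provides an expansion that displays the block for every point of a half-open cylinder.
\<close>

lemma expansion_with_block:
  assumes "1 < b" and "j < b" and "U < b ^ k" and "0 \<le> z" and "z < 1"
  obtains d where "\<And>i. d i < b" and "\<And>i. k \<le> i \<Longrightarrow> i < k + q \<Longrightarrow> d i = j"
    and "expansion b d = (real (U * b ^ q + prefix_value b (\<lambda>_. j) q) + z) / real b ^ (k + q)"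
proof -
  define e where "e = digit b (real U / real b ^ k)"
  define d where "d i = (if i < k then e i else if i < k + q then j else digit b z (i - k - q))" for i
  have b0: "0 < b" using assms(1) by simp
  have "real U < real b ^ k" using assms(3) by (metis of_nat_less_iff of_nat_power)
  then have e: "prefix_value b e k = U"
    using prefix_value_digit[of b "real U / real b ^ k" k] b0 by (simp add: e_def)
  have d: "d i < b" for i using assms digit_less[OF b0] by (auto simp: d_def e_def)
  have "prefix_value b d (k + q) = U * b ^ q + prefix_value b (\<lambda>_. j) q"
    unfolding prefix_value_append e[symmetric]
    by (intro arg_cong2[where f = "(+)"] arg_cong2[where f = "(*)"] prefix_value_cong refl)
      (auto simp: d_def)
  moreover have "(\<lambda>i. d (k + q + i)) = digit b z" by (auto simp: d_def)
  ultimately have "real b ^ (k + q) * expansion b d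
      = real (U * b ^ q + prefix_value b (\<lambda>_. j) q) + z"
    using expansion_prefix[OF assms(1) d, of "k + q"] expansion_digit[OF assms(1,4,5)] by simp
  then have "expansion b d
      = (real (U * b ^ q + prefix_value b (\<lambda>_. j) q) + z) / real b ^ (k + q)"
    using b0 by (simp add: field_simps)
  with d show ?thesis by (intro that[of d]) (auto simp: d_def)
qed

lemma carpet_eq:
  "carpet m n D = {(expansion m x, expansion n y) | x y. \<forall>k. (x k, y k) \<in> D}" (is "?L = ?R")
proof
  show "?L \<subseteq> ?R"
  proof
    fix p assume "p \<in> ?L"
    then obtain x y where "\<forall>k\<ge>1. (x k, y k) \<in> D"
      and "p = (\<Sum>k. real (x (Suc k)) / real m ^ Suc k, \<Sum>k. real (y (Suc k)) / real n ^ Suc k)"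
      unfolding carpet_def by blast
    then have "p = (expansion m (\<lambda>k. x (Suc k)), expansion n (\<lambda>k. y (Suc k)))"
      and "\<forall>k. (x (Suc k), y (Suc k)) \<in> D"
      by (auto simp: expansion_def)
    then show "p \<in> ?R" by blast
  qed
  show "?R \<subseteq> ?L"
  proof
    fix p assume "p \<in> ?R"
    then obtain x y where D: "\<forall>k. (x k, y k) \<in> D" and p: "p = (expansion m x, expansion n y)"
      by blast
    have "p = (\<Sum>k. real (x (Suc k - 1)) / real m ^ Suc k, \<Sum>k. real (y (Suc k - 1)) / real n ^ Suc k)"
      and "\<forall>k\<ge>1. (x (k - 1), y (k - 1)) \<in> D"
      using D p by (auto simp: expansion_def)
    then show "p \<in> ?L"
      unfolding carpet_def mem_Collect_eq
      by (intro exI[of _ "\<lambda>k. x (k - 1)"] exI[of _ "\<lambda>k. y (k - 1)"] conjI)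
  qed
qed

section \<open>Hausdorff dimension from covers and from measures\<close>

text \<open>
  Covering numbers at the single scale \<open>\<eta>\<close>. The bound on diameters is phrased with distances, so
  that no boundedness side condition is attached to the covering sets.
\<close>

definition coverable :: "'a::metric_space set \<Rightarrow> real \<Rightarrow> real \<Rightarrow> bool" where
  "coverable S P \<eta> \<longleftrightarrow> (\<exists>\<U>. finite \<U> \<and> real (card \<U>) \<le> P \<and> S \<subseteq> \<Union>\<U> \<and>
     (\<forall>U\<in>\<U>. \<forall>x\<in>U. \<forall>y\<in>U. dist x y \<le> \<eta>))"

lemma coverableI:
  assumes "finite I" and "real (card I) \<le> P" and "S \<subseteq> (\<Union>i\<in>I. A i)"
    and "\<And>i x y. i \<in> I \<Longrightarrow> x \<in> A i \<Longrightarrow> y \<in> A i \<Longrightarrow> dist x y \<le> \<eta>"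
  shows "coverable S P \<eta>"
proof -
  have "real (card (A ` I)) \<le> P" using assms(2) card_image_le[OF assms(1), of A] by linarith
  moreover have "\<forall>U\<in>A ` I. \<forall>x\<in>U. \<forall>y\<in>U. dist x y \<le> \<eta>" using assms(4) by blast
  ultimately show ?thesis unfolding coverable_def using assms(1,3) by blast
qed

lemma coverableE:
  assumes "coverable S P \<eta>"
  obtains \<U> where "finite \<U>" "real (card \<U>) \<le> P" "S \<subseteq> \<Union>\<U>"
    "\<And>U x y. U \<in> \<U> \<Longrightarrow> x \<in> U \<Longrightarrow> y \<in> U \<Longrightarrow> dist x y \<le> \<eta>"
  using assms unfolding coverable_def by blast

lemma coverable_mono:
  "coverable S P \<eta> \<Longrightarrow> T \<subseteq> S \<Longrightarrow> P \<le> P' \<Longrightarrow> \<eta> \<le> \<eta>' \<Longrightarrow> coverable T P' \<eta>'"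
  unfolding coverable_def by (meson order_trans)

lemma coverable_small:
  "(\<And>x y. x \<in> S \<Longrightarrow> y \<in> S \<Longrightarrow> dist x y \<le> \<eta>) \<Longrightarrow> coverable S 1 \<eta>"
  by (rule coverableI[of "{()}" _ _ "\<lambda>_. S"]) auto

lemma coverable_UN:
  assumes "finite I" and "\<And>i. i \<in> I \<Longrightarrow> coverable (S i) P \<eta>"
  shows "coverable (\<Union>i\<in>I. S i) (real (card I) * P) \<eta>"
proof -
  have "\<exists>\<U>. finite \<U> \<and> real (card \<U>) \<le> P \<and> S i \<subseteq> \<Union>\<U> \<and>
     (\<forall>U\<in>\<U>. \<forall>x\<in>U. \<forall>y\<in>U. dist x y \<le> \<eta>)" if "i \<in> I" for i
    using assms(2)[OF that] unfolding coverable_def .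
  then obtain \<U> where U: "\<And>i. i \<in> I \<Longrightarrow> finite (\<U> i)" "\<And>i. i \<in> I \<Longrightarrow> real (card (\<U> i)) \<le> P"
    "\<And>i. i \<in> I \<Longrightarrow> S i \<subseteq> \<Union>(\<U> i)"
    "\<And>i U x y. i \<in> I \<Longrightarrow> U \<in> \<U> i \<Longrightarrow> x \<in> U \<Longrightarrow> y \<in> U \<Longrightarrow> dist x y \<le> \<eta>"
    by metis
  show ?thesis
  proof (rule coverableI[of "\<Union>i\<in>I. \<U> i" _ _ "\<lambda>U. U"])
    show "finite (\<Union>i\<in>I. \<U> i)" using assms(1) U(1) by blast
    have "real (card (\<Union>i\<in>I. \<U> i)) \<le> (\<Sum>i\<in>I. real (card (\<U> i)))"
      using card_UN_le[OF assms(1), of \<U>] by (metis of_nat_le_iff of_nat_sum)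
    also have "\<dots> \<le> real (card I) * P"
      using U(2) by (intro sum_bounded_above) auto
    finally show "real (card (\<Union>i\<in>I. \<U> i)) \<le> real (card I) * P" .
    show "(\<Union>i\<in>I. S i) \<subseteq> (\<Union>U\<in>(\<Union>i\<in>I. \<U> i). U)" using U(3) by blast
    show "dist x y \<le> \<eta>" if "U \<in> (\<Union>i\<in>I. \<U> i)" "x \<in> U" "y \<in> U" for U x y
      using that U(4) by blast
  qed
qed

lemma coverable_image:
  assumes "coverable S P \<eta>"
    and "\<And>x y. x \<in> S \<Longrightarrow> y \<in> S \<Longrightarrow> dist (f x) (f y) \<le> L * dist x y" and "0 \<le> L"
  shows "coverable (f ` S) P (L * \<eta>)"
  using assms(1)
proof (rule coverableE)
  fix \<U> assume U: "finite \<U>" "real (card \<U>) \<le> P" "S \<subseteq> \<Union>\<U>"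
    and dist: "\<And>U x y. U \<in> \<U> \<Longrightarrow> x \<in> U \<Longrightarrow> y \<in> U \<Longrightarrow> dist x y \<le> \<eta>"
  show ?thesis
  proof (rule coverableI[OF U(1,2), of _ "\<lambda>U. f ` (U \<inter> S)"])
    show "f ` S \<subseteq> (\<Union>U\<in>\<U>. f ` (U \<inter> S))" using U(3) by blast
    fix U x y assume mem: "U \<in> \<U>" "x \<in> f ` (U \<inter> S)" "y \<in> f ` (U \<inter> S)"
    then obtain x' y' where xy: "x = f x'" "y = f y'" "x' \<in> U" "y' \<in> U" "x' \<in> S" "y' \<in> S" by blast
    then have "dist x y \<le> L * dist x' y'" using assms(2) by simp
    also have "\<dots> \<le> L * \<eta>" using dist[OF mem(1) xy(3,4)] assms(3) by (rule mult_left_mono)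
    finally show "dist x y \<le> L * \<eta>" .
  qed
qed

lemma coverable_thicken:
  assumes "coverable S P \<eta>" and "\<And>x. x \<in> M \<Longrightarrow> \<exists>y\<in>S. dist x y \<le> \<rho>"
  shows "coverable M P (\<eta> + 2 * \<rho>)"
  using assms(1)
proof (rule coverableE)
  fix \<U> assume U: "finite \<U>" "real (card \<U>) \<le> P" "S \<subseteq> \<Union>\<U>"
    and dist: "\<And>U x y. U \<in> \<U> \<Longrightarrow> x \<in> U \<Longrightarrow> y \<in> U \<Longrightarrow> dist x y \<le> \<eta>"
  show ?thesis
  proof (rule coverableI[OF U(1,2), of _ "\<lambda>U. {x. \<exists>y\<in>U. dist x y \<le> \<rho>}"])
    show "M \<subseteq> (\<Union>U\<in>\<U>. {x. \<exists>y\<in>U. dist x y \<le> \<rho>})"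
    proof
      fix x assume "x \<in> M"
      then obtain y where y: "y \<in> S" "dist x y \<le> \<rho>" using assms(2) by auto
      then obtain U where "U \<in> \<U>" "y \<in> U" using U(3) by auto
      with y(2) show "x \<in> (\<Union>U\<in>\<U>. {x. \<exists>y\<in>U. dist x y \<le> \<rho>})" by auto
    qed
    fix U x x' assume mem: "U \<in> \<U>" "x \<in> {x. \<exists>y\<in>U. dist x y \<le> \<rho>}" "x' \<in> {x. \<exists>y\<in>U. dist x y \<le> \<rho>}"
    then obtain y y' where y: "y \<in> U" "y' \<in> U" "dist x y \<le> \<rho>" "dist x' y' \<le> \<rho>" by auto
    have "dist y y' \<le> \<eta>" by (rule dist[OF mem(1) y(1,2)])
    with y(3,4) show "dist x x' \<le> \<eta> + 2 * \<rho>"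
      using dist_triangle[of x x' y] dist_triangle[of y x' y'] dist_commute[of y' x'] by linarith
  qed
qed

lemma hausdorff_premeasure_le_of_coverable:
  assumes cov: "coverable M P \<eta>" and "0 < s" and "0 < \<eta>" and "\<eta> \<le> \<delta>"
  shows "hausdorff_premeasure s \<delta> M \<le> ennreal (P * \<eta> powr s)"
proof -
  obtain \<U> where U: "finite \<U>" "real (card \<U>) \<le> P" "M \<subseteq> \<Union>\<U>"
    and dist: "\<forall>U\<in>\<U>. \<forall>x\<in>U. \<forall>y\<in>U. dist x y \<le> \<eta>"
    using cov unfolding coverable_def by blast
  obtain f where f: "bij_betw f {0..<card \<U>} \<U>" using ex_bij_betw_nat_finite[OF U(1)] by blast
  define V where "V i = (if i < card \<U> then f i else {})" for i
  have mem: "V i \<in> \<U>" if "i < card \<U>" for i using that f by (auto simp: V_def bij_betw_def)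
  have bd: "bounded (V i)" for i
  proof (cases "i < card \<U>")
    case True
    then show ?thesis using mem dist unfolding bounded_two_points by blast
  qed (simp add: V_def)
  have diam: "diameter (V i) \<le> \<eta>" for i
  proof (cases "V i = {}")
    case False
    then have "i < card \<U>" by (auto simp: V_def split: if_splits)
    then have "dist x y \<le> \<eta>" if "x \<in> V i" "y \<in> V i" for x y using mem dist that by blast
    then show ?thesis using False unfolding diameter_def by (auto intro!: cSUP_least)
  qed (use assms in auto)
  have "(\<Sum>i. diam_gauge s (V i)) = (\<Sum>i<card \<U>. diam_gauge s (V i))"
    by (rule suminf_finite) (auto simp: V_def diam_gauge_def)
  also have "\<dots> \<le> (\<Sum>i<card \<U>. ennreal (\<eta> powr s))"
  proof (rule sum_mono)
    fix i
    show "diam_gauge s (V i) \<le> ennreal (\<eta> powr s)"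
      using diam[of i] diameter_ge_0[OF bd[of i]] assms(2)
      by (auto simp: diam_gauge_def intro!: ennreal_leI powr_mono2)
  qed
  also have "\<dots> = ennreal (real (card \<U>) * \<eta> powr s)" by (simp add: ennreal_mult' ennreal_of_nat_eq_real_of_nat)
  also have "\<dots> \<le> ennreal (P * \<eta> powr s)" using U(2) by (intro ennreal_leI mult_right_mono) auto
  finally have le: "(\<Sum>i. diam_gauge s (V i)) \<le> ennreal (P * \<eta> powr s)" .
  have "M \<subseteq> (\<Union>i. V i)"
  proof
    fix x assume "x \<in> M"
    then obtain W where "W \<in> \<U>" "x \<in> W" using U(3) by blast
    moreover have "f ` {0..<card \<U>} = \<U>" using f by (rule bij_betw_imp_surj_on)
    ultimately obtain i where "i < card \<U>" "f i = W" by (metis atLeastLessThan_iff imageE)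
    then show "x \<in> (\<Union>i. V i)" using \<open>x \<in> W\<close> by (auto simp: V_def)
  qed
  moreover have "diameter (V i) \<le> \<delta>" for i using diam[of i] assms(4) by linarith
  ultimately have "hausdorff_premeasure s \<delta> M \<le> (\<Sum>i. diam_gauge s (V i))"
    unfolding hausdorff_premeasure_def using bd by (intro Inf_lower) blast
  with le show ?thesis by order
qed

lemma hausdorff_dim_le_of_coverable:
  assumes "0 < s"
    and cov: "\<And>\<epsilon>. 0 < \<epsilon> \<Longrightarrow> \<exists>P \<eta>. coverable M P \<eta> \<and> 0 < \<eta> \<and> \<eta> \<le> \<epsilon> \<and> P * \<eta> powr s \<le> \<epsilon>"
  shows "hausdorff_dim M \<le> ereal s"
proof -
  have "hausdorff_premeasure s \<delta> M = 0" if "0 < \<delta>" for \<delta>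
  proof (rule ccontr)
    assume "hausdorff_premeasure s \<delta> M \<noteq> 0"
    then have "0 < hausdorff_premeasure s \<delta> M" by (simp add: zero_less_iff_neq_zero)
    then obtain c where c: "0 < c" "c < hausdorff_premeasure s \<delta> M" using dense by blast
    then obtain e where e: "0 < e" "ennreal e < hausdorff_premeasure s \<delta> M"
      by (cases c) (auto simp: ennreal_less_zero_iff)
    then have "0 < min \<delta> e" using that by simp
    then obtain P \<eta> where "coverable M P \<eta>" "0 < \<eta>" "\<eta> \<le> min \<delta> e" "P * \<eta> powr s \<le> min \<delta> e"
      using cov by blast
    then have "hausdorff_premeasure s \<delta> M \<le> ennreal (P * \<eta> powr s)"
      using assms(1) by (intro hausdorff_premeasure_le_of_coverable) auto
    also have "\<dots> \<le> ennreal e" using \<open>P * \<eta> powr s \<le> min \<delta> e\<close> by (intro ennreal_leI) auto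
    finally show False using e(2) by (simp add: leD)
  qed
  then have "hausdorff_outer_measure s M = 0"
    unfolding hausdorff_outer_measure_def by (auto intro!: antisym SUP_least)
  then show ?thesis unfolding hausdorff_dim_def using assms(1) by (intro Inf_lower) auto
qed

text \<open>
  If \<open>\<H>\<^bsup>s'\<^esup>(E) = 0\<close> for some \<open>s' < s\<close>, then \<open>E\<close> has covers with arbitrarily small gauge sum. Pulling
  such a cover back along \<open>h\<close> covers \<open>S\<close> by sets of total mass at most a constant times this sum,
  so that \<open>S\<close> would be a null set. Using a parametrisation \<open>h\<close> by a familiar measure space
  avoids constructing a measure on \<open>E\<close>, and the sets \<open>G\<close> avoid measurability of preimages.
\<close>

lemma mass_distribution:
  fixes h :: "'b \<Rightarrow> 'a::metric_space" and \<mu> :: "'b measure"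
  assumes s: "0 \<le> s"
    and S: "S \<in> sets \<mu>" "emeasure \<mu> S \<noteq> 0"
    and hS: "h ` S \<subseteq> E"
    and C: "0 \<le> C"
    and mass: "\<And>T \<eta>. T \<subseteq> S \<Longrightarrow> 0 < \<eta> \<Longrightarrow> \<eta> \<le> 1 \<Longrightarrow> (\<And>z z'. z \<in> T \<Longrightarrow> z' \<in> T \<Longrightarrow> dist (h z) (h z') \<le> \<eta>)
       \<Longrightarrow> \<exists>G\<in>sets \<mu>. T \<subseteq> G \<and> emeasure \<mu> G \<le> ennreal (C * \<eta> powr s)"
  shows "ereal s \<le> hausdorff_dim E"
  unfolding hausdorff_dim_def
proof (rule Inf_greatest, clarify)
  fix s' :: real assume s': "0 \<le> s'" and zero: "hausdorff_outer_measure s' E = 0"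
  show "ereal s \<le> ereal s'"
  proof (rule ccontr)
    assume "\<not> ereal s \<le> ereal s'"
    then have less: "s' < s" by simp
    have cover_mass: "\<exists>G\<in>sets \<mu>. {z \<in> S. h z \<in> U} \<subseteq> G \<and> emeasure \<mu> G \<le> ennreal C * diam_gauge s' U"
      if bU: "bounded U" and dU: "diameter U \<le> 1" for U
    proof (cases "U = {}")
      case False
      have dist: "dist (h z) (h z') \<le> diameter U" if "z \<in> {z \<in> S. h z \<in> U}" "z' \<in> {z \<in> S. h z \<in> U}" for z z'
        using that diameter_bounded_bound[OF bU] by auto
      show ?thesis
      \<comment> \<open>A covering set of diameter \<open>0\<close> has gauge \<open>0\<close> when \<open>s' > 0\<close>, so its preimage must lie in a null set: intersect the sets obtained for \<open>\<eta> = 1 / (i + 1)\<close>.\<close>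
      proof (cases "diameter U = 0")
        case True
        have "\<exists>G\<in>sets \<mu>. {z \<in> S. h z \<in> U} \<subseteq> G \<and> emeasure \<mu> G \<le> ennreal (C * (1 / real (Suc i)) powr s)" for i
        proof (rule mass)
          fix z z' assume "z \<in> {z \<in> S. h z \<in> U}" "z' \<in> {z \<in> S. h z \<in> U}"
          then have "dist (h z) (h z') \<le> 0" using dist[of z z'] True by simp
          also have "\<dots> \<le> 1 / real (Suc i)" by simp
          finally show "dist (h z) (h z') \<le> 1 / real (Suc i)" .
        qed auto
        then obtain G where G: "\<And>i. G i \<in> sets \<mu>" "\<And>i. {z \<in> S. h z \<in> U} \<subseteq> G i"
          "\<And>i. emeasure \<mu> (G i) \<le> ennreal (C * (1 / real (Suc i)) powr s)"
          by metis
        have sets: "(\<Inter>i. G i) \<in> sets \<mu>" using G(1) by auto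
        have "(\<lambda>i. ennreal (C * (1 / real (Suc i)) powr s)) \<longlonglongrightarrow> ennreal (C * 0)"
        proof (intro tendsto_ennrealI tendsto_mult tendsto_const)
          have "(\<lambda>i. 1 / real (Suc i)) \<longlonglongrightarrow> 0" using LIMSEQ_Suc[OF lim_1_over_n] by simp
          then show "(\<lambda>i. (1 / real (Suc i)) powr s) \<longlonglongrightarrow> 0"
            by (rule tendsto_zero_powrI) (use less s' in auto)
        qed
        moreover have "emeasure \<mu> (\<Inter>i. G i) \<le> ennreal (C * (1 / real (Suc i)) powr s)" for i
          using G(3)[of i] emeasure_mono[OF INT_lower[of i UNIV G] G(1)] by (meson UNIV_I order_trans)
        ultimately have "emeasure \<mu> (\<Inter>i. G i) \<le> ennreal (C * 0)"
          by (intro LIMSEQ_le_const) auto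
        then show ?thesis using sets G(2) by (intro bexI[of _ "\<Inter>i. G i"]) auto
      next
        case False
        then have pos: "0 < diameter U" using diameter_ge_0[OF bU] by linarith
        obtain G where G: "G \<in> sets \<mu>" "{z \<in> S. h z \<in> U} \<subseteq> G"
          "emeasure \<mu> G \<le> ennreal (C * diameter U powr s)"
          using mass[of "{z \<in> S. h z \<in> U}" "diameter U"] dist pos dU by auto
        note G(3)
        also have "ennreal (C * diameter U powr s) \<le> ennreal (C * diameter U powr s')"
          using pos dU less C by (intro ennreal_leI mult_left_mono powr_mono') auto
        also have "\<dots> = ennreal C * diam_gauge s' U"
          using \<open>U \<noteq> {}\<close> C pos by (auto simp: diam_gauge_def ennreal_mult)
        finally show ?thesis using G by blast
      qed
    qed (auto simp: diam_gauge_def)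
    have "emeasure \<mu> S \<le> ennreal C * \<epsilon>" if "0 < \<epsilon>" for \<epsilon>
    proof -
      have "hausdorff_premeasure s' 1 E \<le> hausdorff_outer_measure s' E"
        unfolding hausdorff_outer_measure_def by (rule SUP_upper) simp
      with zero that have "hausdorff_premeasure s' 1 E < \<epsilon>" by simp
      then obtain U :: "nat \<Rightarrow> 'a set" where U: "(\<Sum>i. diam_gauge s' (U i)) < \<epsilon>" "E \<subseteq> (\<Union>i. U i)"
        "\<And>i. bounded (U i) \<and> diameter (U i) \<le> 1"
        unfolding hausdorff_premeasure_def Inf_less_iff by blast
      have "\<exists>G\<in>sets \<mu>. {z \<in> S. h z \<in> U i} \<subseteq> G \<and> emeasure \<mu> G \<le> ennreal C * diam_gauge s' (U i)" for i
        using cover_mass U(3) by blast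
      then obtain G where G: "\<And>i. G i \<in> sets \<mu>" "\<And>i. {z \<in> S. h z \<in> U i} \<subseteq> G i"
        "\<And>i. emeasure \<mu> (G i) \<le> ennreal C * diam_gauge s' (U i)"
        by metis
      have "S \<subseteq> (\<Union>i. G i)"
      proof
        fix z assume "z \<in> S"
        then obtain i where "h z \<in> U i" using hS U(2) by blast
        then show "z \<in> (\<Union>i. G i)" using G(2) \<open>z \<in> S\<close> by blast
      qed
      then have "emeasure \<mu> S \<le> emeasure \<mu> (\<Union>i. G i)" using G(1) by (intro emeasure_mono) auto
      also have "\<dots> \<le> (\<Sum>i. emeasure \<mu> (G i))" using G(1) by (intro emeasure_subadditive_countably) auto
      also have "\<dots> \<le> (\<Sum>i. ennreal C * diam_gauge s' (U i))" using G(3) by (intro suminf_le) auto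
      also have "\<dots> = ennreal C * (\<Sum>i. diam_gauge s' (U i))" by simp
      also have "\<dots> \<le> ennreal C * \<epsilon>" using U(1) by (intro mult_left_mono) auto
      finally show ?thesis .
    qed
    then have "emeasure \<mu> S \<le> ennreal C * ennreal (1 / real (Suc i))" for i by simp
    then have "emeasure \<mu> S \<le> ennreal (C * (1 / real (Suc i)))" for i
      by (subst ennreal_mult) (use C in auto)
    moreover have "(\<lambda>i. ennreal (C * (1 / real (Suc i)))) \<longlonglongrightarrow> ennreal (C * 0)"
      using LIMSEQ_Suc[OF lim_1_over_n] by (intro tendsto_ennrealI tendsto_mult tendsto_const) 
    ultimately have "emeasure \<mu> S \<le> ennreal (C * 0)" by (intro LIMSEQ_le_const) auto
    then show False using S(2) by simp
  qed
qed

section \<open>Sets of reals with restricted digits\<close>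

definition digit_set :: "nat \<Rightarrow> nat set \<Rightarrow> real set" where
  "digit_set m A = {expansion m w | w. \<forall>i. w i \<in> A}"

lemma mem_digit_set: "x \<in> digit_set b A \<longleftrightarrow> (\<exists>w. (\<forall>i. w i \<in> A) \<and> x = expansion b w)"
  unfolding digit_set_def by auto

text \<open>
  The depth at which cylinders of base \<open>b\<close> have length comparable to \<open>\<eta>\<close>.
\<close>

lemma scale_exists:
  assumes "1 < b" and "0 < \<eta>" and "\<eta> \<le> 1"
  obtains k where "1 / real b ^ Suc k < \<eta>" and "\<eta> \<le> 1 / real b ^ k"
proof -
  obtain j where "(1 / real b) ^ j < \<eta>"
    using real_arch_pow_inv[of \<eta> "1 / real b"] assms by auto
  moreover have "(1 / real b) ^ Suc j \<le> (1 / real b) ^ j"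
    using assms(1) by (intro power_decreasing) auto
  ultimately have ex: "\<exists>k. 1 / real b ^ Suc k < \<eta>"
    unfolding power_one_over by (meson le_less_trans)
  define k where "k = (LEAST k. 1 / real b ^ Suc k < \<eta>)"
  have "1 / real b ^ Suc k < \<eta>" unfolding k_def using ex by (rule LeastI_ex)
  moreover have "\<eta> \<le> 1 / real b ^ k"
  proof (cases k)
    case (Suc l)
    have "\<not> 1 / real b ^ Suc l < \<eta>"
      by (rule not_less_Least) (use Suc in \<open>simp add: k_def\<close>)
    then show ?thesis using Suc by simp
  qed (use assms in auto)
  ultimately show ?thesis by (rule that)
qed

lemma power_powr_log:
  assumes "1 < m" and "1 \<le> N"
  shows "(1 / real m ^ k) powr log (real m) (real N) = 1 / real N ^ k"
proof -
  let ?L = "log (real m) (real N)"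
  have "(real m ^ k) powr ?L = (real m powr real k) powr ?L"
    using assms by (simp add: powr_realpow)
  also have "\<dots> = (real m powr ?L) powr real k" by (simp add: powr_powr mult.commute)
  also have "\<dots> = real N ^ k" using assms by (simp add: powr_realpow)
  finally show ?thesis using assms by (simp add: powr_divide)
qed

text \<open>
  The map sending a number in base \<open>N\<close> to the number in base \<open>m\<close> with digits relabelled by \<open>a\<close>
  parametrises a digit set, and Lebesgue measure plays the role of the self-similar measure. If
  the values of the map on \<open>T\<close> are within \<open>\<eta> \<approx> m\<^bsup>-k\<^esup>\<close>, only five prefixes \<open>W\<close> of length \<open>k\<close>
  occur. Relabelling is injective, so each prefix comes from one interval of length \<open>N\<^bsup>-k\<^esup>\<close>, and
  \<open>N\<^bsup>-k\<^esup>\<close> is comparable to \<open>\<eta>\<^bsup>s\<^esup>\<close> with \<open>s = log\<^bsub>m\<^esub> N\<close>.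
\<close>

lemma digit_relabelling_mass:
  fixes a :: "nat \<Rightarrow> nat"
  assumes m: "1 < m" and N: "1 \<le> N" and inj: "inj_on a {..<N}" and less: "\<And>i. i < N \<Longrightarrow> a i < m"
    and T: "T \<subseteq> {0..<1}" and \<eta>: "0 < \<eta>" "\<eta> \<le> 1"
    and close: "\<And>z z'. z \<in> T \<Longrightarrow> z' \<in> T \<Longrightarrow>
      \<bar>expansion m (\<lambda>i. a (digit N z i)) - expansion m (\<lambda>i. a (digit N z' i))\<bar> \<le> \<eta>"
  shows "\<exists>G\<in>sets lborel. T \<subseteq> G \<and>
    emeasure lborel G \<le> ennreal (5 * real N * \<eta> powr log (real m) (real N))"
proof (cases "T = {}")
  case True
  then show ?thesis by (intro bexI[of _ "{}"]) auto
next
  case False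
  then obtain z0 where z0: "z0 \<in> T" by blast
  obtain k where k: "1 / real m ^ Suc k < \<eta>" "\<eta> \<le> 1 / real m ^ k"
    using scale_exists[OF m \<eta>] by blast
  let ?h = "\<lambda>z. expansion m (\<lambda>i. a (digit N z i))"
  define W where "W z = prefix_value m (\<lambda>i. a (digit N z i)) k" for z
  define V where "V z = prefix_value N (digit N z) k" for z
  have dl: "digit N z i < N" for z i using N by (simp add: digit_less)
  have am: "a (digit N z i) < m" for z i using dl less by blast
  have VW: "V z = V z'" if "W z = W z'" for z z'
    unfolding V_def
  proof (rule prefix_value_cong)
    fix i assume "i < k"
    have "a (digit N z i) = a (digit N z' i)"
      by (rule prefix_value_inject[OF am am that[unfolded W_def] \<open>i < k\<close>])
    then show "digit N z i = digit N z' i" using inj dl by (auto simp: inj_on_def)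
  qed
  define c where "c w = (SOME v. \<exists>z\<in>T. W z = w \<and> V z = v)" for w
  have c: "c (W z) = V z" if "z \<in> T" for z
    unfolding c_def
  proof (rule some_equality)
    show "\<exists>y\<in>T. W y = W z \<and> V y = V z" using that by blast
    fix v assume "\<exists>y\<in>T. W y = W z \<and> V y = v"
    then obtain y where "W y = W z" "V y = v" by blast
    then show "v = V z" using VW[of y z] by simp
  qed
  define I where "I = {W z0 - 2..W z0 + 2}"
  define J where "J w = {real (c w) / real N ^ k..(real (c w) + 1) / real N ^ k}" for w
  have WI: "W z \<in> I" if "z \<in> T" for z
  proof -
    have "\<bar>real m ^ k * ?h z - real m ^ k * ?h z0\<bar> = real m ^ k * \<bar>?h z - ?h z0\<bar>"
      by (simp add: abs_mult flip: right_diff_distrib)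
    also have "\<dots> \<le> real m ^ k * (1 / real m ^ k)"
      using close[OF that z0] k(2) by (intro mult_left_mono) auto
    also have "\<dots> = 1" using m by simp
    finally have "\<bar>real m ^ k * ?h z - real m ^ k * ?h z0\<bar> \<le> 1" .
    moreover have W: "real (W y) \<le> real m ^ k * ?h y \<and> real m ^ k * ?h y \<le> real (W y) + 1" for y
      unfolding W_def using expansion_bounds[of m "\<lambda>i. a (digit N y i)" k] m am by blast
    ultimately have "\<bar>real (W z) - real (W z0)\<bar> \<le> 2" using W[of z] W[of z0] by linarith
    then show ?thesis unfolding I_def by auto
  qed
  have "T \<subseteq> (\<Union>w\<in>I. J w)"
  proof
    fix z assume z: "z \<in> T"
    then have "0 \<le> z" "z < 1" using T by auto
    then have "real (V z) = real_of_int \<lfloor>real N ^ k * z\<rfloor>"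
      unfolding V_def using prefix_value_digit[of N z k] N by simp
    then have "real (V z) \<le> real N ^ k * z" "real N ^ k * z \<le> real (V z) + 1" by linarith+
    then have "z \<in> J (W z)" using N c[OF z] by (simp add: J_def field_simps)
    with WI[OF z] show "z \<in> (\<Union>w\<in>I. J w)" by blast
  qed
  moreover have "emeasure lborel (\<Union>w\<in>I. J w) \<le> ennreal (5 * real N * \<eta> powr log (real m) (real N))"
  proof -
    have "emeasure lborel (\<Union>w\<in>I. J w) \<le> (\<Sum>w\<in>I. emeasure lborel (J w))"
      by (rule emeasure_subadditive_finite) (auto simp: I_def J_def)
    also have "\<dots> = (\<Sum>w\<in>I. ennreal (1 / real N ^ k))"
    proof (rule sum.cong[OF refl])
      fix w
      have "(real (c w) + 1) / real N ^ k - real (c w) / real N ^ k = 1 / real N ^ k"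
        by (simp flip: diff_divide_distrib)
      then show "emeasure lborel (J w) = ennreal (1 / real N ^ k)"
        unfolding J_def by (subst emeasure_lborel_Icc) (simp_all add: divide_right_mono)
    qed
    also have "\<dots> = ennreal (real (card I) * (1 / real N ^ k))"
      by (subst ennreal_mult) (auto simp: ennreal_of_nat_eq_real_of_nat)
    also have "\<dots> \<le> ennreal (5 * real N * \<eta> powr log (real m) (real N))"
    proof (rule ennreal_leI)
      have "1 / real N ^ Suc k = (1 / real m ^ Suc k) powr log (real m) (real N)"
        using power_powr_log[OF m N] by presburger
      also have "\<dots> \<le> \<eta> powr log (real m) (real N)"
        using k(1) m N by (intro powr_mono2) auto
      finally have "real N * (1 / real N ^ Suc k) \<le> real N * \<eta> powr log (real m) (real N)"
        by (intro mult_left_mono) auto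
      then have "1 / real N ^ k \<le> real N * \<eta> powr log (real m) (real N)" using N by simp
      moreover have "real (card I) \<le> 5" unfolding I_def by simp
      ultimately have "real (card I) * (1 / real N ^ k) \<le> 5 * (real N * \<eta> powr log (real m) (real N))"
        by (intro mult_mono) auto
      then show "real (card I) * (1 / real N ^ k) \<le> 5 * real N * \<eta> powr log (real m) (real N)"
        by simp
    qed
    finally show ?thesis .
  qed
  moreover have "(\<Union>w\<in>I. J w) \<in> sets lborel" by (auto simp: I_def J_def)
  ultimately show ?thesis by blast
qed

text \<open>
  Projection to the abscissa does not increase distances, so the mass bound for the digit set
  transfers to any graph over it.
\<close>

lemma hausdorff_dim_digit_set_graph:
  assumes m: "1 < m" and A: "A \<noteq> {}" "A \<subseteq> {..<m}"
    and M: "\<And>x. x \<in> digit_set m A \<Longrightarrow> (x, g x) \<in> M"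
  shows "ereal (log (real m) (real (card A))) \<le> hausdorff_dim (M :: (real \<times> real) set)"
proof -
  have fin: "finite A" using A(2) finite_subset by blast
  then have N: "1 \<le> card A" using A(1) by (simp add: Suc_leI card_gt_0_iff)
  obtain a where a: "bij_betw a {..<card A} A"
    using ex_bij_betw_nat_finite[OF fin] by (auto simp: lessThan_atLeast0)
  then have inj: "inj_on a {..<card A}" and mem: "\<And>i. i < card A \<Longrightarrow> a i \<in> A"
    by (auto simp: bij_betw_def)
  define h where "h z = expansion m (\<lambda>i. a (digit (card A) z i))" for z
  have hE: "h z \<in> digit_set m A" for z
    unfolding digit_set_def h_def using mem digit_less N by auto
  show ?thesis
  proof (rule mass_distribution[where \<mu> = lborel and S = "{0..<1}" and h = "\<lambda>z. (h z, g (h z))"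
        and C = "5 * real (card A)"])
    show "(\<lambda>z. (h z, g (h z))) ` {0..<1} \<subseteq> M" using hE M by auto
    fix T :: "real set" and \<eta> :: real
    assume T: "T \<subseteq> {0..<1}" and \<eta>: "0 < \<eta>" "\<eta> \<le> 1"
      and dist: "\<And>z z'. z \<in> T \<Longrightarrow> z' \<in> T \<Longrightarrow> dist (h z, g (h z)) (h z', g (h z')) \<le> \<eta>"
    show "\<exists>G\<in>sets lborel. T \<subseteq> G \<and>
      emeasure lborel G \<le> ennreal (5 * real (card A) * \<eta> powr log (real m) (real (card A)))"
    proof (rule digit_relabelling_mass[OF m N inj _ T \<eta>])
      fix z z' assume "z \<in> T" "z' \<in> T"
      then show "\<bar>expansion m (\<lambda>i. a (digit (card A) z i)) - expansion m (\<lambda>i. a (digit (card A) z' i))\<bar> \<le> \<eta>"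
        using dist[of z z'] dist_fst_le[of "(h z, g (h z))" "(h z', g (h z'))"]
        by (simp add: dist_real_def flip: h_def)
    qed (use mem A(2) in auto)
  qed (use m N in auto)
qed

text \<open>
  The parametrising measure is the product of Lebesgue measures: a set of diameter \<open>\<eta>\<close> has mass
  \<open>O(\<eta>\<^bsup>s\<^esup>)\<close> in the digit factor and \<open>O(\<eta>)\<close> in the interval.
\<close>

lemma hausdorff_dim_digit_set_times_interval:
  assumes m: "1 < m" and A: "A \<noteq> {}" "A \<subseteq> {..<m}"
    and M: "digit_set m A \<times> {0..1/2} \<subseteq> M"
  shows "ereal (1 + log (real m) (real (card A))) \<le> hausdorff_dim (M :: (real \<times> real) set)"
proof -
  have fin: "finite A" using A(2) finite_subset by blast
  then have N: "1 \<le> card A" using A(1) by (simp add: Suc_leI card_gt_0_iff)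
  obtain a where a: "bij_betw a {..<card A} A"
    using ex_bij_betw_nat_finite[OF fin] by (auto simp: lessThan_atLeast0)
  then have inj: "inj_on a {..<card A}" and mem: "\<And>i. i < card A \<Longrightarrow> a i \<in> A"
    by (auto simp: bij_betw_def)
  define h where "h z = expansion m (\<lambda>i. a (digit (card A) z i))" for z
  have hE: "h z \<in> digit_set m A" for z
    unfolding digit_set_def h_def using mem digit_less N by auto
  define H where "H z = (h (fst z), snd z)" for z :: "real \<times> real"
  let ?s = "log (real m) (real (card A))"
  have prod: "emeasure (lborel \<Otimes>\<^sub>M lborel) (P \<times> Q) = emeasure lborel P * emeasure lborel Q"
    if "P \<in> sets lborel" "Q \<in> sets lborel" for P Q :: "real set"
    using that by (rule lborel.emeasure_pair_measure_Times)
  show ?thesis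
  proof (rule mass_distribution[where \<mu> = "lborel \<Otimes>\<^sub>M lborel" and S = "{0..<1} \<times> {0..1/2}" and h = H
        and C = "10 * real (card A)"])
    show "{0..<1} \<times> {0..1/2} \<in> sets (lborel \<Otimes>\<^sub>M lborel :: (real \<times> real) measure)" by (intro pair_measureI) auto
    show "emeasure (lborel \<Otimes>\<^sub>M lborel) ({0..<1} \<times> {0..1/2} :: (real \<times> real) set) \<noteq> 0"
      by (subst prod) auto
    show "H ` ({0..<1} \<times> {0..1/2}) \<subseteq> M" using hE M by (auto simp: H_def)
    fix T :: "(real \<times> real) set" and \<eta> :: real
    assume T: "T \<subseteq> {0..<1} \<times> {0..1/2}" and \<eta>: "0 < \<eta>" "\<eta> \<le> 1"
      and dist: "\<And>z z'. z \<in> T \<Longrightarrow> z' \<in> T \<Longrightarrow> dist (H z) (H z') \<le> \<eta>"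
    have "\<exists>G\<in>sets lborel. fst ` T \<subseteq> G \<and> emeasure lborel G \<le> ennreal (5 * real (card A) * \<eta> powr ?s)"
    proof (rule digit_relabelling_mass[OF m N inj _ _ \<eta>])
      fix z z' assume "z \<in> fst ` T" "z' \<in> fst ` T"
      then obtain p p' where p: "p \<in> T" "p' \<in> T" "z = fst p" "z' = fst p'" by blast
      then show "\<bar>expansion m (\<lambda>i. a (digit (card A) z i)) - expansion m (\<lambda>i. a (digit (card A) z' i))\<bar> \<le> \<eta>"
        using dist[OF p(1,2)] dist_fst_le[of "H p" "H p'"]
        by (simp add: H_def dist_real_def flip: h_def)
    qed (use mem A(2) T in auto)
    then obtain G where G: "G \<in> sets lborel" "fst ` T \<subseteq> G"
      "emeasure lborel G \<le> ennreal (5 * real (card A) * \<eta> powr ?s)" by blast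
    show "\<exists>G\<in>sets (lborel \<Otimes>\<^sub>M lborel). T \<subseteq> G \<and>
      emeasure (lborel \<Otimes>\<^sub>M lborel) G \<le> ennreal (10 * real (card A) * \<eta> powr (1 + ?s))"
    proof (cases "T = {}")
      case True
      then show ?thesis by (intro bexI[of _ "{}"]) auto
    next
      case False
      then obtain z0 where z0: "z0 \<in> T" by blast
      let ?Q = "{snd z0 - \<eta>..snd z0 + \<eta>}"
      have "T \<subseteq> G \<times> ?Q"
      proof
        fix z assume z: "z \<in> T"
        then have "\<bar>snd z - snd z0\<bar> \<le> \<eta>"
          using dist[OF z z0] dist_snd_le[of "H z" "H z0"] by (simp add: H_def dist_real_def)
        then have "snd z \<in> ?Q" by auto
        moreover have "fst z \<in> G" using z G(2) by auto
        ultimately show "z \<in> G \<times> ?Q" by (simp add: mem_Times_iff)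
      qed
      moreover have "emeasure (lborel \<Otimes>\<^sub>M lborel) (G \<times> ?Q) = emeasure lborel G * ennreal (2 * \<eta>)"
        using G(1) \<eta> by (subst prod) auto
      moreover have "\<dots> \<le> ennreal (5 * real (card A) * \<eta> powr ?s) * ennreal (2 * \<eta>)"
        using G(3) by (intro mult_right_mono) auto
      moreover have "\<dots> = ennreal (10 * real (card A) * \<eta> powr (1 + ?s))"
        using \<eta> by (subst ennreal_mult[symmetric]) (auto simp: powr_add algebra_simps)
      moreover have "G \<times> ?Q \<in> sets (lborel \<Otimes>\<^sub>M lborel)" using G(1) by (intro pair_measureI) auto
      ultimately show ?thesis by (metis (no_types, lifting))
    qed
  qed (use m N in auto)
qed

section \<open>Microsets\<close>

lemma bdd_above_infdist:
  fixes A B :: "'a::metric_space set"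
  assumes "bounded A" and "bounded B" and "B \<noteq> {}"
  shows "bdd_above ((\<lambda>a. infdist a B) ` A)"
proof -
  obtain b where b: "b \<in> B" using assms(3) by blast
  obtain e where e: "\<forall>a\<in>A. dist b a \<le> e" using assms(1) unfolding bounded_any_center[of _ b] by blast
  show ?thesis
  proof (rule bdd_aboveI2)
    fix a assume "a \<in> A"
    then show "infdist a B \<le> e" using e infdist_le[OF b, of a] by (simp add: dist_commute) (meson order_trans)
  qed
qed

lemma hausdorff_distD:
  fixes A B :: "'a::metric_space set"
  assumes "bounded A" "bounded B" "A \<noteq> {}" and less: "hausdorff_dist A B < \<rho>" and b: "b \<in> B"
  shows "\<exists>a\<in>A. dist b a \<le> \<rho>"
proof -
  have "infdist b A \<le> (SUP b\<in>B. infdist b A)"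
    using bdd_above_infdist[OF assms(2,1,3)] b by (rule cSUP_upper2) simp
  then have "infdist b A < \<rho>" using less unfolding hausdorff_dist_def by linarith
  then have "(INF a\<in>A. dist b a) < \<rho>" using assms(3) by (simp add: infdist_notempty)
  then obtain a where "a \<in> A" "dist b a < \<rho>"
    using assms(3) by (subst (asm) cINF_less_iff) (auto intro: bdd_belowI2[of _ 0])
  then show ?thesis by (intro bexI[of _ a]) auto
qed

lemma hausdorff_dist_nonneg:
  fixes A B :: "'a::metric_space set"
  assumes "bounded A" "bounded B" "A \<noteq> {}" "B \<noteq> {}"
  shows "0 \<le> hausdorff_dist A B"
proof -
  obtain a where a: "a \<in> A" using assms(3) by blast
  have "0 \<le> infdist a B" by (rule infdist_nonneg)
  also have "\<dots> \<le> (SUP a\<in>A. infdist a B)"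
    using bdd_above_infdist[OF assms(1,2,4)] a by (rule cSUP_upper2) simp
  finally show ?thesis unfolding hausdorff_dist_def by linarith
qed

lemma hausdorff_dist_le:
  fixes A B :: "'a::metric_space set"
  assumes "A \<noteq> {}" "B \<noteq> {}" and "\<And>a. a \<in> A \<Longrightarrow> \<exists>b\<in>B. dist a b \<le> \<rho>" and "\<And>b. b \<in> B \<Longrightarrow> \<exists>a\<in>A. dist b a \<le> \<rho>"
  shows "hausdorff_dist A B \<le> \<rho>"
  unfolding hausdorff_dist_def
  using assms by (intro max.boundedI cSUP_least) (auto intro: infdist_le2)

lemma bounded_unit_window: "bounded unit_window"
  unfolding unit_window_def by (intro bounded_Times bounded_closed_interval)

text \<open>
  The linear factor is the loss permitted in the covers of a slice; it does not affect dimension.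
\<close>

lemma n_times_power_tendsto_0:
  fixes r :: real
  assumes "0 \<le> r" "r < 1"
  shows "(\<lambda>k. (real k + 1) * r ^ k) \<longlonglongrightarrow> 0"
proof -
  have "(\<lambda>k. real k * r ^ k + r ^ k) \<longlonglongrightarrow> 0 + 0"
    using assms by (intro tendsto_add powser_times_n_limit_0 LIMSEQ_realpow_zero) auto
  then show ?thesis by (simp add: algebra_simps)
qed

lemma hausdorff_dim_le_of_power_covers:
  fixes b C :: real and m :: nat
  assumes m: "1 < m" and b: "1 \<le> b" and C: "0 < C"
    and cov: "\<And>K. \<exists>k\<ge>K. coverable M (C * (real k + 1) * b ^ k) (C / real m ^ k)"
  shows "hausdorff_dim M \<le> ereal (log (real m) b)"
proof (rule ereal_le_epsilon2)
  fix e :: real assume e: "0 < e"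
  define s where "s = log (real m) b + e"
  have s: "0 < s" using e m b by (simp add: s_def add_nonneg_pos)
  have ms: "real m powr s = b * real m powr e" using m b by (simp add: s_def powr_add)
  define r where "r = 1 / real m powr e"
  have "1 < real m powr e" using m e by (intro gr_one_powr) auto
  then have r: "0 < r" "r < 1" using m by (auto simp: r_def divide_less_eq)
  have "hausdorff_dim M \<le> ereal s"
  proof (rule hausdorff_dim_le_of_coverable[OF s])
    fix \<epsilon> :: real assume \<epsilon>: "0 < \<epsilon>"
    have "(\<lambda>k. C * (1 / real m) ^ k) \<longlonglongrightarrow> C * 0"
      using m by (intro tendsto_mult tendsto_const LIMSEQ_realpow_zero) auto
    then have "\<forall>\<^sub>F k in sequentially. C * (1 / real m) ^ k < \<epsilon>" using \<epsilon> by (intro order_tendstoD) auto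
    moreover have "(\<lambda>k. C * C powr s * ((real k + 1) * r ^ k)) \<longlonglongrightarrow> C * C powr s * 0"
      using r by (intro tendsto_mult tendsto_const n_times_power_tendsto_0) auto
    then have "\<forall>\<^sub>F k in sequentially. C * C powr s * ((real k + 1) * r ^ k) < \<epsilon>"
      using \<epsilon> by (intro order_tendstoD) auto
    ultimately have "\<forall>\<^sub>F k in sequentially. C * (1 / real m) ^ k < \<epsilon> \<and> C * C powr s * ((real k + 1) * r ^ k) < \<epsilon>"
      by (rule eventually_conj)
    then obtain K where K: "\<And>k. K \<le> k \<Longrightarrow> C * (1 / real m) ^ k < \<epsilon> \<and> C * C powr s * ((real k + 1) * r ^ k) < \<epsilon>"
      unfolding eventually_sequentially by blast
    obtain k where k: "K \<le> k" "coverable M (C * (real k + 1) * b ^ k) (C / real m ^ k)" using cov by blast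
    have "(C / real m ^ k) powr s = C powr s / (real m powr s) ^ k"
      using C m by (simp add: powr_divide powr_realpow[symmetric] powr_powr mult.commute)
    also have "(real m powr s) ^ k = b ^ k / r ^ k" using ms by (simp add: r_def power_mult_distrib power_divide)
    finally have "C * (real k + 1) * b ^ k * (C / real m ^ k) powr s = C * C powr s * ((real k + 1) * r ^ k)"
      using b r by simp
    moreover have "C / real m ^ k < \<epsilon>" using K[OF k(1)] by (simp add: power_divide)
    moreover have "0 < C / real m ^ k" using C m by simp
    ultimately show "\<exists>P \<eta>. coverable M P \<eta> \<and> 0 < \<eta> \<and> \<eta> \<le> \<epsilon> \<and> P * \<eta> powr s \<le> \<epsilon>"
      using k(2) K[OF k(1)] by (metis less_imp_le)
  qed
  then show "hausdorff_dim M \<le> ereal (log (real m) b) + ereal e" by (simp add: s_def)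
qed

lemma coverable_similarity:
  fixes S :: "'a::real_normed_vector set"
  assumes "coverable S P \<eta>" and "0 \<le> a"
  shows "coverable ((\<lambda>p. a *\<^sub>R p + v) ` S) P (a * \<eta>)"
proof (rule coverable_image[OF assms(1) _ assms(2)])
  fix p p' :: 'a
  have "dist (a *\<^sub>R p + v) (a *\<^sub>R p' + v) = norm (a *\<^sub>R (p - p'))"
    by (simp add: dist_norm scaleR_diff_right)
  then show "dist (a *\<^sub>R p + v) (a *\<^sub>R p' + v) \<le> a * dist p p'" using assms(2) by (simp add: dist_norm)
qed

text \<open>
  Two kinds of microsets have to be covered. If the magnifications \<open>a\<^sub>i\<close> are unbounded, the
  hypothesis \<open>micro\<close> applies at every depth \<open>q\<close> to some miniset that is within \<open>m\<^bsup>-q\<^esup>\<close> of the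
  microset. If they are eventually bounded, covers of \<open>X\<close> itself are magnified by a bounded factor;
  here infinitely many scales suffice. Passing to a nearby miniset replaces any compactness
  argument for the maps \<open>p \<mapsto> a\<^sub>i p + v\<^sub>i\<close>.
\<close>

lemma star_dim_le_of_covers:
  fixes b C :: real and m :: nat
  assumes m: "1 < m" and b: "1 \<le> b" and C: "0 < C"
    and micro: "\<And>q. \<exists>a0. \<forall>a\<ge>a0. \<forall>v. coverable ((\<lambda>p. a *\<^sub>R p + v) ` X \<inter> unit_window) (C * b ^ q) (C / real m ^ q)"
    and macro: "\<And>K. \<exists>k\<ge>K. coverable X (C * (real k + 1) * b ^ k) (C / real m ^ k)"
  shows "star_dim X \<le> ereal (log (real m) b)"
  unfolding star_dim_def
proof (rule Sup_least, clarify)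
  fix M assume "microset X M"
  then obtain A where M: "M \<noteq> {}" "M \<subseteq> unit_window" and mini: "\<And>i. miniset X (A i)"
    and lim: "(\<lambda>i. hausdorff_dist (A i) M) \<longlonglongrightarrow> 0"
    unfolding microset_def by blast
  have "\<exists>a v. 1 \<le> a \<and> A i \<subseteq> (\<lambda>p. a *\<^sub>R p + v) ` X \<inter> unit_window" for i
    using mini[of i] unfolding miniset_def by blast
  then obtain a v where a: "\<And>i. 1 \<le> a i" and A: "\<And>i. A i \<subseteq> (\<lambda>p. a i *\<^sub>R p + v i) ` X \<inter> unit_window"
    by metis
  have bM: "bounded M" using M(2) bounded_unit_window bounded_subset by blast
  have bA: "bounded (A i)" for i using A bounded_unit_window bounded_subset by blast
  have transfer: "coverable M P ((c + 2) / real m ^ k)"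
    if "coverable (A i) P (c / real m ^ k)" "hausdorff_dist (A i) M < 1 / real m ^ k" for i P c k
  proof -
    have "A i \<noteq> {}" using mini[of i] unfolding miniset_def by blast
    then have "\<exists>y\<in>A i. dist x y \<le> 1 / real m ^ k" if "x \<in> M" for x
      using that \<open>hausdorff_dist (A i) M < 1 / real m ^ k\<close> by (intro hausdorff_distD[OF bA bM])
    then have "coverable M P (c / real m ^ k + 2 * (1 / real m ^ k))"
      by (rule coverable_thicken[OF that(1)])
    then show ?thesis by (simp add: add_divide_distrib)
  qed
  have near: "\<exists>I. \<forall>i\<ge>I. hausdorff_dist (A i) M < 1 / real m ^ k" for k
  proof -
    have "0 < 1 / real m ^ k" using m by simp
    from order_tendstoD(2)[OF lim this] show ?thesis unfolding eventually_sequentially .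
  qed
  have "\<exists>C'>0. \<forall>K. \<exists>k\<ge>K. coverable M (C' * (real k + 1) * b ^ k) (C' / real m ^ k)"
  proof (cases "\<forall>a0 I. \<exists>i\<ge>I. a0 \<le> a i")
    case True
    have "coverable M ((C + 2) * (real q + 1) * b ^ q) ((C + 2) / real m ^ q)" for q
    proof -
      obtain a0 where a0: "\<And>a v. a0 \<le> a \<Longrightarrow> coverable ((\<lambda>p. a *\<^sub>R p + v) ` X \<inter> unit_window) (C * b ^ q) (C / real m ^ q)"
        using micro by blast
      obtain I where I: "\<And>i. I \<le> i \<Longrightarrow> hausdorff_dist (A i) M < 1 / real m ^ q" using near by blast
      obtain i where i: "I \<le> i" "a0 \<le> a i" using True by blast
      have "coverable (A i) (C * b ^ q) (C / real m ^ q)"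
        using a0[OF i(2)] A by (rule coverable_mono) auto
      then have "coverable M (C * b ^ q) ((C + 2) / real m ^ q)" using I[OF i(1)] by (rule transfer)
      moreover have "C * b ^ q \<le> (C + 2) * (real q + 1) * b ^ q"
      proof (rule mult_right_mono)
        have "C * 1 \<le> (C + 2) * (real q + 1)" using C by (intro mult_mono) auto
        then show "C \<le> (C + 2) * (real q + 1)" by simp
      qed (use b in auto)
      ultimately show ?thesis by (blast intro: coverable_mono)
    qed
    then show ?thesis using C by (intro exI[of _ "C + 2"]) auto
  next
    case False
    then obtain a0 I where a0: "\<And>i. I \<le> i \<Longrightarrow> a i < a0" by (meson not_le)
    have a1: "1 < a0" using a0[of I] a[of I] by simp
    define C' where "C' = a0 * C + 2"
    have CC: "C \<le> C'" using mult_right_mono[of 1 a0 C] a1 C unfolding C'_def by linarith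
    have "\<exists>k\<ge>K. coverable M (C' * (real k + 1) * b ^ k) (C' / real m ^ k)" for K
    proof -
      obtain k where k: "K \<le> k" "coverable X (C * (real k + 1) * b ^ k) (C / real m ^ k)" using macro by blast
      obtain J where J: "\<And>i. J \<le> i \<Longrightarrow> hausdorff_dist (A i) M < 1 / real m ^ k" using near by blast
      define i where "i = max I J"
      have "coverable ((\<lambda>p. a i *\<^sub>R p + v i) ` X) (C * (real k + 1) * b ^ k) (a i * (C / real m ^ k))"
        using a[of i] by (intro coverable_similarity[OF k(2)]) auto
      moreover have "a i * (C / real m ^ k) \<le> a0 * C / real m ^ k"
        using a0[of i] C m by (simp add: i_def divide_right_mono mult_right_mono)
      moreover have "C * (real k + 1) * b ^ k \<le> C' * (real k + 1) * b ^ k"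
        using CC b by (intro mult_right_mono) auto
      ultimately have "coverable (A i) (C' * (real k + 1) * b ^ k) (a0 * C / real m ^ k)"
        using A[of i] by (blast intro: coverable_mono)
      then have "coverable M (C' * (real k + 1) * b ^ k) (C' / real m ^ k)"
        unfolding C'_def using J[of i] by (intro transfer[of i]) (auto simp: i_def)
      then show ?thesis using k(1) by blast
    qed
    moreover have "0 < C'" using CC C by linarith
    ultimately show ?thesis by blast
  qed
  then obtain C' where "0 < C'" "\<And>K. \<exists>k\<ge>K. coverable M (C' * (real k + 1) * b ^ k) (C' / real m ^ k)"
    by blast
  then show "hausdorff_dim M \<le> ereal (log (real m) b)" by (rule hausdorff_dim_le_of_power_covers[OF m b])
qed

section \<open>Counting the cells of a carpet\<close>

locale full_column_carpet =
  fixes m n :: nat and D :: "(nat \<times> nat) set" and i0 j0 :: nat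
  assumes n_gt_1: "1 < n" and n_less_m: "n < m"
    and digits: "D \<subseteq> {0..<m} \<times> {0..<n}"
    and full_column: "\<And>j. j < n \<Longrightarrow> (i0, j) \<in> D"
    and j0_less: "j0 < n"
    and largest_row: "\<And>j. card {i. (i, j) \<in> D} \<le> card {i. (i, j0) \<in> D}"
begin

definition N :: nat where "N = card {i. (i, j0) \<in> D}"

definition valid :: "(nat \<Rightarrow> nat) \<Rightarrow> (nat \<Rightarrow> nat) \<Rightarrow> bool" where
  "valid x y \<longleftrightarrow> (\<forall>k. (x k, y k) \<in> D)"

text \<open>
  The part of the carpet in the rectangle of width \<open>m\<^bsup>-k\<^esup>\<close> and height \<open>n\<^bsup>-k\<^esup>\<close> with lower
  left corner \<open>(W m\<^bsup>-k\<^esup>, V n\<^bsup>-k\<^esup>)\<close>, but restricted to expansions that display this rectangle.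
\<close>

definition cell :: "nat \<Rightarrow> nat \<Rightarrow> nat \<Rightarrow> (real \<times> real) set" where
  "cell k W V = {(expansion m x, expansion n y) | x y.
     valid x y \<and> prefix_value m x k = W \<and> prefix_value n y k = V}"

definition codes :: "nat \<Rightarrow> (nat \<times> nat) set" where
  "codes k = {(prefix_value m x k, prefix_value n y k) | x y. valid x y}"

text \<open>
  Horizontal prefixes of length \<open>k + q\<close> that continue \<open>W\<close> while all vertical digits up to depth
  \<open>k + q\<close> are prescribed by \<open>V\<close>.
\<close>

definition extensions :: "nat \<Rightarrow> nat \<Rightarrow> nat \<Rightarrow> nat \<Rightarrow> nat set" where
  "extensions k q W V = {prefix_value m x (k + q) | x y.
     valid x y \<and> prefix_value m x k = W \<and> prefix_value n y (k + q) = V}"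

lemma m_gt_1: "1 < m" using n_gt_1 n_less_m by simp

lemma carpet_eq_valid: "carpet m n D = {(expansion m x, expansion n y) | x y. valid x y}"
  unfolding carpet_eq valid_def by simp

lemma valid_less: "valid x y \<Longrightarrow> x k < m" "valid x y \<Longrightarrow> y k < n"
  using digits unfolding valid_def by fastforce+

lemma finite_D: "finite D" using digits finite_subset by blast

lemma finite_row: "finite {i. (i, j) \<in> D}"
proof -
  have "{i. (i, j) \<in> D} \<subseteq> fst ` D" by force
  then show ?thesis using finite_D finite_subset by blast
qed

lemma row_le_N: "card {i. (i, j) \<in> D} \<le> N" unfolding N_def by (rule largest_row)

lemma N_pos: "1 \<le> N"
proof -
  have "i0 \<in> {i. (i, j0) \<in> D}" using full_column[OF j0_less] by simp
  then have "card {i. (i, j0) \<in> D} \<noteq> 0" using finite_row[of j0] by auto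
  then show ?thesis unfolding N_def by simp
qed

lemma card_D_le: "card D \<le> n * N"
proof -
  have "D \<subseteq> (\<Union>j\<in>{..<n}. (\<lambda>i. (i, j)) ` {i. (i, j) \<in> D})"
  proof
    fix d assume "d \<in> D"
    then have "snd d < n" "d \<in> (\<lambda>i. (i, snd d)) ` {i. (i, snd d) \<in> D}" using digits by (auto simp: image_iff)
    then show "d \<in> (\<Union>j\<in>{..<n}. (\<lambda>i. (i, j)) ` {i. (i, j) \<in> D})" by blast
  qed
  then have "card D \<le> card (\<Union>j\<in>{..<n}. (\<lambda>i. (i, j)) ` {i. (i, j) \<in> D})"
    using finite_row by (intro card_mono) auto
  also have "\<dots> \<le> (\<Sum>j<n. card ((\<lambda>i. (i, j)) ` {i. (i, j) \<in> D}))" by (rule card_UN_le) simp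
  also have "\<dots> \<le> (\<Sum>j<n. N)"
    by (intro sum_mono order_trans[OF card_image_le row_le_N] finite_row)
  finally show ?thesis by simp
qed

text \<open>
  Every step appends an element of \<open>D\<close>, and \<open>D\<close> has at most \<open>n\<close> rows of at most \<open>N\<close> digits.
\<close>

lemma codes_finite_card: "finite (codes k) \<and> card (codes k) \<le> (n * N) ^ k"
proof (induction k)
  case 0
  have "codes 0 \<subseteq> {(0, 0)}" unfolding codes_def by auto
  then show ?case using card_mono[of "{(0, 0)}" "codes 0"] finite_subset by auto
next
  case (Suc k)
  let ?f = "\<lambda>((W, V), (i, j)). (m * W + i, n * V + j)"
  have sub: "codes (Suc k) \<subseteq> ?f ` (codes k \<times> D)"
  proof
    fix c assume "c \<in> codes (Suc k)"
    then obtain x y where v: "valid x y" and c: "c = (prefix_value m x (Suc k), prefix_value n y (Suc k))"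
      unfolding codes_def by blast
    have "c = ?f ((prefix_value m x k, prefix_value n y k), (x k, y k))" using c by simp
    moreover have "(prefix_value m x k, prefix_value n y k) \<in> codes k" unfolding codes_def using v by blast
    moreover have "(x k, y k) \<in> D" using v unfolding valid_def by simp
    ultimately show "c \<in> ?f ` (codes k \<times> D)" by blast
  qed
  have fin: "finite (codes k \<times> D)" using Suc finite_D by simp
  have "card (codes (Suc k)) \<le> card (codes k \<times> D)" using sub fin by (rule surj_card_le[rotated])
  also have "\<dots> \<le> (n * N) ^ k * (n * N)"
    unfolding card_cartesian_product using Suc card_D_le by (intro mult_le_mono) auto
  finally show ?case using sub fin finite_surj by (auto simp: mult.commute)
qed

text \<open>
  Every step appends a digit from the row that the next vertical digit \<open>V mod n\<close> prescribes.
\<close>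

lemma extensions_finite_card: "finite (extensions k q W V) \<and> card (extensions k q W V) \<le> N ^ q"
proof (induction q arbitrary: V)
  case 0
  have "extensions k 0 W V \<subseteq> {W}" unfolding extensions_def by auto
  then show ?case using card_mono[of "{W}" "extensions k 0 W V"] finite_subset by auto
next
  case (Suc q)
  let ?R = "{i. (i, V mod n) \<in> D}"
  let ?f = "\<lambda>(W', i). m * W' + i"
  have sub: "extensions k (Suc q) W V \<subseteq> ?f ` (extensions k q W (V div n) \<times> ?R)"
  proof
    fix c assume "c \<in> extensions k (Suc q) W V"
    then obtain x y where v: "valid x y" and c: "c = prefix_value m x (k + Suc q)"
      and W: "prefix_value m x k = W" and V: "prefix_value n y (k + Suc q) = V"
      unfolding extensions_def by blast
    have "y (k + q) < n" using valid_less(2)[OF v] .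
    moreover have "V = n * prefix_value n y (k + q) + y (k + q)" using V by simp
    ultimately have "V div n = prefix_value n y (k + q)" "V mod n = y (k + q)" by auto
    then have "prefix_value m x (k + q) \<in> extensions k q W (V div n)" "x (k + q) \<in> ?R"
      using v W unfolding extensions_def valid_def by auto
    moreover have "c = ?f (prefix_value m x (k + q), x (k + q))" using c by simp
    ultimately show "c \<in> ?f ` (extensions k q W (V div n) \<times> ?R)" by blast
  qed
  have fin: "finite (extensions k q W (V div n) \<times> ?R)" using Suc finite_row by simp
  have "card (extensions k (Suc q) W V) \<le> card (extensions k q W (V div n) \<times> ?R)"
    using sub fin by (rule surj_card_le[rotated])
  also have "\<dots> \<le> N ^ q * N"
    unfolding card_cartesian_product using Suc row_le_N by (intro mult_le_mono) auto
  finally show ?case using sub fin finite_surj by (auto simp: mult.commute)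
qed

text \<open>
  The heart of the upper bounds. A window of width \<open>2 m\<^bsup>-k\<^esup>\<close> that is so flat that it
  determines the vertical digits to depth \<open>k + q\<close> up to a bounded ambiguity meets only
  \<open>O(N\<^bsup>q\<^esup>)\<close> cells of level \<open>k + q\<close>: there are at most \<open>7\<close> choices for the horizontal prefix of
  length \<open>k\<close>, at most \<open>5\<close> for the vertical one, and then the vertical digits leave at most \<open>N\<close>
  choices for each further horizontal digit.
\<close>

lemma local_codes:
  assumes P: "P \<subseteq> carpet m n D"
    and x: "\<And>p p'. p \<in> P \<Longrightarrow> p' \<in> P \<Longrightarrow> \<bar>fst p - fst p'\<bar> \<le> 2 / real m ^ k"
    and y: "\<And>p p'. p \<in> P \<Longrightarrow> p' \<in> P \<Longrightarrow> \<bar>snd p - snd p'\<bar> \<le> 1 / real n ^ (k + q)"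
  obtains I where "finite I" "card I \<le> 35 * N ^ q" "P \<subseteq> (\<Union>(W, V)\<in>I. cell (k + q) W V)"
proof (cases "P = {}")
  case True
  then show ?thesis by (intro that[of "{}"]) auto
next
  case False
  then obtain p0 where p0: "p0 \<in> P" by blast
  then obtain x0 y0 where v0: "valid x0 y0" and p0_eq: "p0 = (expansion m x0, expansion n y0)"
    using P unfolding carpet_eq_valid by blast
  define A where "A = {prefix_value m x0 k - 3..prefix_value m x0 k + 3}"
  define B where "B = {prefix_value n y0 (k + q) - 2..prefix_value n y0 (k + q) + 2}"
  define I where "I = (\<Union>(W1, V)\<in>A \<times> B. (\<lambda>W. (W, V)) ` extensions k q W1 V)"
  have finAB: "finite (A \<times> B)" unfolding A_def B_def by simp
  have "finite I" unfolding I_def using finAB extensions_finite_card by (auto simp: A_def B_def)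
  moreover have "card I \<le> 35 * N ^ q"
  proof -
    have "card I \<le> (\<Sum>c\<in>A \<times> B. card (case c of (W1, V) \<Rightarrow> (\<lambda>W. (W, V)) ` extensions k q W1 V))"
      unfolding I_def by (rule card_UN_le[OF finAB])
    also have "\<dots> \<le> (\<Sum>c\<in>A \<times> B. N ^ q)"
    proof (rule sum_mono)
      fix c assume "c \<in> A \<times> B"
      have "card ((\<lambda>W. (W, snd c)) ` extensions k q (fst c) (snd c)) \<le> N ^ q"
        using card_image_le[of "extensions k q (fst c) (snd c)" "\<lambda>W. (W, snd c)"]
          extensions_finite_card[of k q "fst c" "snd c"] by linarith
      then show "card (case c of (W1, V) \<Rightarrow> (\<lambda>W. (W, V)) ` extensions k q W1 V) \<le> N ^ q"
        by (simp add: case_prod_beta)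
    qed
    also have "\<dots> = card A * card B * N ^ q" by (simp add: card_cartesian_product)
    also have "\<dots> \<le> 7 * 5 * N ^ q"
      by (intro mult_le_mono) (auto simp: A_def B_def)
    finally show ?thesis by simp
  qed
  moreover have "P \<subseteq> (\<Union>(W, V)\<in>I. cell (k + q) W V)"
  proof
    fix p assume p: "p \<in> P"
    then obtain x' y' where v: "valid x' y'" and p_eq: "p = (expansion m x', expansion n y')"
      using P unfolding carpet_eq_valid by blast
    have "prefix_value m x' k \<in> A"
      unfolding A_def using prefix_value_close[of m x' x0 2 k] valid_less v v0 m_gt_1 x[OF p p0] p_eq p0_eq by (simp add: eval_nat_numeral)
    moreover have "prefix_value n y' (k + q) \<in> B"
      unfolding B_def using prefix_value_close[of n y' y0 1 "k + q"] valid_less v v0 n_gt_1 y[OF p p0] p_eq p0_eq by (simp add: numeral_2_eq_2)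
    moreover have "prefix_value m x' (k + q) \<in> extensions k q (prefix_value m x' k) (prefix_value n y' (k + q))"
      unfolding extensions_def using v by blast
    ultimately have "(prefix_value m x' (k + q), prefix_value n y' (k + q)) \<in> I" unfolding I_def by blast
    moreover have "p \<in> cell (k + q) (prefix_value m x' (k + q)) (prefix_value n y' (k + q))"
      unfolding cell_def using v p_eq by blast
    ultimately show "p \<in> (\<Union>(W, V)\<in>I. cell (k + q) W V)" by blast
  qed
  ultimately show ?thesis by (rule that)
qed

lemma cell_bounds:
  assumes "p \<in> cell k W V"
  shows "real W / real m ^ k \<le> fst p" and "fst p \<le> real W / real m ^ k + 1 / real m ^ k"
    and "real V / real n ^ k \<le> snd p" and "snd p \<le> real V / real n ^ k + 1 / real n ^ k"
proof -
  obtain x y where v: "valid x y" and p: "p = (expansion m x, expansion n y)"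
    and WV: "prefix_value m x k = W" "prefix_value n y k = V"
    using assms unfolding cell_def by blast
  show "real W / real m ^ k \<le> fst p" "fst p \<le> real W / real m ^ k + 1 / real m ^ k"
    using expansion_bounds[of m x k] valid_less(1)[OF v] m_gt_1 WV p by (simp_all add: field_simps)
  show "real V / real n ^ k \<le> snd p" "snd p \<le> real V / real n ^ k + 1 / real n ^ k"
    using expansion_bounds[of n y k] valid_less(2)[OF v] n_gt_1 WV p by (simp_all add: field_simps)
qed

lemma cell_close:
  assumes "p \<in> cell k W V" and "p' \<in> cell k W V"
  shows "\<bar>fst p - fst p'\<bar> \<le> 1 / real m ^ k" and "\<bar>snd p - snd p'\<bar> \<le> 1 / real n ^ k"
  using cell_bounds[OF assms(1)] cell_bounds[OF assms(2)] by linarith+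

lemma carpet_subset_cells: "carpet m n D \<subseteq> (\<Union>(W, V)\<in>codes k. cell k W V)"
  unfolding carpet_eq_valid codes_def cell_def by blast

text \<open>
  The disparity of the two bases; it is what makes square windows flat in the sense of
  \<open>local_codes\<close> once they are small.
\<close>

lemma ratio_eventually:
  fixes B :: real
  obtains K where "\<And>k. K \<le> k \<Longrightarrow> B * real n ^ k \<le> real m ^ k"
proof -
  have r: "1 < real m / real n" using n_gt_1 n_less_m by simp
  obtain K where K: "B < (real m / real n) ^ K" using real_arch_pow[OF r] by blast
  show ?thesis
  proof (rule that)
    fix k assume "K \<le> k"
    then have "(real m / real n) ^ K \<le> (real m / real n) ^ k" using r by (intro power_increasing) auto
    then have "B \<le> (real m / real n) ^ k" using K by linarith
    then show "B * real n ^ k \<le> real m ^ k" using n_gt_1 by (simp add: power_divide field_simps)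
  qed
qed

section \<open>Upper bounds for star dimensions\<close>

text \<open>
  The exponent \<open>\<kappa>\<close> is the dimension of \<open>X\<close> inside a thin cell: by hypothesis \<open>slab\<close>, a piece of
  height \<open>L m\<^bsup>-k\<^esup>\<close> of a cell of level \<open>k\<close> needs \<open>O(L\<^bsup>\<kappa>\<^esup>)\<close> sets of diameter \<open>O(m\<^bsup>-k\<^esup>)\<close>. It is \<open>1\<close> for
  the carpet and \<open>0\<close> for a slice. A window of size \<open>1 / a\<close> with \<open>m\<^bsup>k\<^esup> \<le> a < m\<^bsup>k+1\<^esup>\<close>
  meets \<open>O(N\<^bsup>q\<^esup>)\<close> cells of level \<open>k + q\<close>, each in a piece of height \<open>2 m\<^bsup>q\<^esup> m\<^bsup>-(k+q)\<^esup>\<close>, so it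
  needs \<open>O((N m\<^bsup>\<kappa>\<^esup>)\<^bsup>q\<^esup>)\<close> sets, whose diameters become \<open>O(m\<^bsup>-q\<^esup>)\<close> after magnification.
\<close>

proposition star_dim_le_of_cells:
  fixes X :: "(real \<times> real) set" and C :: real and \<kappa> :: nat
  assumes X: "X \<subseteq> carpet m n D" and C: "1 \<le> C"
    and slab: "\<And>k W V T L. 1 \<le> L \<Longrightarrow> T \<subseteq> X \<inter> cell k W V \<Longrightarrow>
        (\<And>p p'. p \<in> T \<Longrightarrow> p' \<in> T \<Longrightarrow> \<bar>snd p - snd p'\<bar> \<le> L / real m ^ k) \<Longrightarrow>
        coverable T (C * L ^ \<kappa>) (C / real m ^ k)"
    and macro: "\<And>K. \<exists>k\<ge>K. coverable X (C * (real k + 1) * (real N * real m ^ \<kappa>) ^ k) (C / real m ^ k)"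
  shows "star_dim X \<le> ereal (log (real m) (real N * real m ^ \<kappa>))"
proof (rule star_dim_le_of_covers[OF m_gt_1])
  have m1: "1 \<le> real m" using m_gt_1 by simp
  define b where "b = real N * real m ^ \<kappa>"
  have "1 * 1 \<le> b" unfolding b_def using N_pos m1 by (intro mult_mono one_le_power) auto
  then show b: "1 \<le> real N * real m ^ \<kappa>" by (simp add: b_def)
  \<comment> \<open>One constant for the number of sets and for their diameters: \<open>35\<close> comes from \<open>local_codes\<close>, \<open>2 ^ \<kappa>\<close> from \<open>L = 2 * m ^ q\<close>, and \<open>m\<close> from \<open>a < m ^ Suc k\<close>.\<close>
  define C' where "C' = 35 * C * 2 ^ \<kappa> * real m"
  have one: "1 \<le> (2::real) ^ \<kappa>" by simp
  have "35 * C * 1 * 1 \<le> 35 * C * 2 ^ \<kappa> * real m" using C m1 one by (intro mult_mono) auto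
  then have CC: "35 * C \<le> C'" by (simp add: C'_def)
  have C1: "35 * C * 2 ^ \<kappa> \<le> C'" unfolding C'_def using C m1 one mult_left_mono[of 1 "real m" "35 * C * 2 ^ \<kappa>"] by simp
  have "C * 1 * real m \<le> 35 * C * 2 ^ \<kappa> * real m" using C m1 one by (intro mult_mono) auto
  then have C2: "C * real m \<le> C'" by (simp add: C'_def)
  show "0 < 35 * C * 2 ^ \<kappa> * real m" using C m1 by simp
  show "\<exists>k\<ge>K. coverable X (35 * C * 2 ^ \<kappa> * real m * (real k + 1) * (real N * real m ^ \<kappa>) ^ k)
      (35 * C * 2 ^ \<kappa> * real m / real m ^ k)" for K
  proof -
    obtain k where k: "K \<le> k" "coverable X (C * (real k + 1) * b ^ k) (C / real m ^ k)"
      using macro[of K] unfolding b_def by blast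
    have CleC': "C \<le> C'" using CC C by linarith
    have "C * (real k + 1) * b ^ k \<le> C' * (real k + 1) * b ^ k"
      using CleC' b by (intro mult_right_mono) (auto simp: b_def)
    moreover have "C / real m ^ k \<le> C' / real m ^ k" using CleC' m1 by (intro divide_right_mono) auto
    ultimately have "coverable X (C' * (real k + 1) * b ^ k) (C' / real m ^ k)"
      using k(2) by (blast intro: coverable_mono)
    then show ?thesis using k(1) unfolding C'_def b_def by blast
  qed
  show "\<exists>a0. \<forall>a\<ge>a0. \<forall>v. coverable ((\<lambda>p. a *\<^sub>R p + v) ` X \<inter> unit_window)
      (35 * C * 2 ^ \<kappa> * real m * (real N * real m ^ \<kappa>) ^ q) (35 * C * 2 ^ \<kappa> * real m / real m ^ q)" for q
  proof -
    obtain K where K: "\<And>k. K \<le> k \<Longrightarrow> 2 * real n ^ q * real n ^ k \<le> real m ^ k"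
      using ratio_eventually[of "2 * real n ^ q"] by blast
    have "coverable ((\<lambda>p. a *\<^sub>R p + v) ` X \<inter> unit_window) (C' * b ^ q) (C' / real m ^ q)"
      if a: "real m ^ K \<le> a" for a v
    proof -
      have a1: "1 \<le> a" using a m1 one_le_power[of "real m" K] by linarith
      obtain k where "1 / real m ^ Suc k < 1 / a" "1 / a \<le> 1 / real m ^ k"
        using scale_exists[of m "1 / a"] m_gt_1 a1 by auto
      then have k: "a < real m ^ Suc k" "real m ^ k \<le> a" using a1 m1 by (auto simp: field_simps)
      have "real m ^ K < real m ^ Suc k" using a k(1) by linarith
      then have "K < Suc k" using m_gt_1 by (intro power_less_imp_less_exp[of "real m"]) auto
      then have fine: "2 * real n ^ q * real n ^ k \<le> real m ^ k" using K by simp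
      define P where "P = {p \<in> X. a *\<^sub>R p + v \<in> unit_window}"
      have Pwin: "\<bar>fst p - fst p'\<bar> \<le> 2 / real m ^ k" "\<bar>snd p - snd p'\<bar> \<le> 2 / real m ^ k"
        if "p \<in> P" "p' \<in> P" for p p'
      proof -
        have "\<bar>a * fst p - a * fst p'\<bar> \<le> 2" "\<bar>a * snd p - a * snd p'\<bar> \<le> 2"
          using that unfolding P_def unit_window_def by (auto simp: mem_Times_iff)
        then have "a * \<bar>fst p - fst p'\<bar> \<le> 2" "a * \<bar>snd p - snd p'\<bar> \<le> 2"
          using a1 by (auto simp: abs_mult simp flip: right_diff_distrib)
        then have "\<bar>fst p - fst p'\<bar> \<le> 2 / a" "\<bar>snd p - snd p'\<bar> \<le> 2 / a"
          using a1 by (auto simp: field_simps)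
        moreover have "2 / a \<le> 2 / real m ^ k" using k(2) m1 a1 by (intro divide_left_mono mult_pos_pos) auto
        ultimately show "\<bar>fst p - fst p'\<bar> \<le> 2 / real m ^ k" "\<bar>snd p - snd p'\<bar> \<le> 2 / real m ^ k"
          by linarith+
      qed
      have "2 / real m ^ k \<le> 1 / real n ^ (k + q)"
        using fine n_gt_1 m_gt_1 by (simp add: field_simps power_add)
      then have Pwin2: "\<bar>snd p - snd p'\<bar> \<le> 1 / real n ^ (k + q)" if "p \<in> P" "p' \<in> P" for p p'
        using Pwin(2)[OF that] by linarith
      have PX: "P \<subseteq> X" unfolding P_def by blast
      then have PF: "P \<subseteq> carpet m n D" using X by blast
      obtain I where I: "finite I" "card I \<le> 35 * N ^ q" "P \<subseteq> (\<Union>(W, V)\<in>I. cell (k + q) W V)"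
        by (rule local_codes[OF PF Pwin(1) Pwin2])
      have "coverable (\<Union>c\<in>I. P \<inter> cell (k + q) (fst c) (snd c))
          (real (card I) * (C * (2 * real m ^ q) ^ \<kappa>)) (C / real m ^ (k + q))"
      proof (rule coverable_UN[OF I(1)])
        fix c assume "c \<in> I"
        show "coverable (P \<inter> cell (k + q) (fst c) (snd c)) (C * (2 * real m ^ q) ^ \<kappa>) (C / real m ^ (k + q))"
        proof (rule slab)
          have "1 \<le> real m ^ q" using m1 by simp
          then show "1 \<le> 2 * real m ^ q" by linarith
          show "P \<inter> cell (k + q) (fst c) (snd c) \<subseteq> X \<inter> cell (k + q) (fst c) (snd c)" using PX by blast
          fix p p' assume "p \<in> P \<inter> cell (k + q) (fst c) (snd c)" "p' \<in> P \<inter> cell (k + q) (fst c) (snd c)"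
          then have "\<bar>snd p - snd p'\<bar> \<le> 2 / real m ^ k" using Pwin(2) by blast
          then show "\<bar>snd p - snd p'\<bar> \<le> 2 * real m ^ q / real m ^ (k + q)"
            using m1 by (simp add: power_add)
        qed
      qed
      moreover have "P \<subseteq> (\<Union>c\<in>I. P \<inter> cell (k + q) (fst c) (snd c))"
        using I(3) by (auto simp: case_prod_beta)
      moreover have "real (card I) * (C * (2 * real m ^ q) ^ \<kappa>) \<le> C' * b ^ q"
      proof -
        have "real (card I) \<le> real (35 * N ^ q)" using I(2) by (rule of_nat_mono)
        then have "real (card I) * (C * (2 * real m ^ q) ^ \<kappa>) \<le> real (35 * N ^ q) * (C * (2 * real m ^ q) ^ \<kappa>)"
          using C by (intro mult_right_mono) auto
        also have "\<dots> = 35 * C * 2 ^ \<kappa> * b ^ q"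
          by (simp add: b_def power_mult_distrib flip: power_mult) (simp add: mult.commute)
        also have "\<dots> \<le> C' * b ^ q" using C1 b by (intro mult_right_mono) (auto simp: b_def)
        finally show ?thesis .
      qed
      ultimately have "coverable P (C' * b ^ q) (C / real m ^ (k + q))" by (blast intro: coverable_mono)
      then have "coverable ((\<lambda>p. a *\<^sub>R p + v) ` P) (C' * b ^ q) (a * (C / real m ^ (k + q)))"
        using a1 by (intro coverable_similarity) auto
      moreover have "(\<lambda>p. a *\<^sub>R p + v) ` X \<inter> unit_window \<subseteq> (\<lambda>p. a *\<^sub>R p + v) ` P" unfolding P_def by blast
      moreover have "a * (C / real m ^ (k + q)) \<le> C' / real m ^ q"
      proof -
        have "a * (C / real m ^ (k + q)) \<le> real m ^ Suc k * (C / real m ^ (k + q))"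
          using k(1) C by (intro mult_right_mono) auto
        also have "\<dots> = C * real m / real m ^ q" using m1 by (simp add: power_add)
        also have "\<dots> \<le> C' / real m ^ q" using C2 by (intro divide_right_mono) auto
        finally show ?thesis .
      qed
      ultimately show ?thesis by (blast intro: coverable_mono)
    qed
    then show ?thesis unfolding C'_def b_def by blast
  qed
qed

text \<open>
  Cutting the piece of a cell into horizontal strips of height \<open>m\<^bsup>-k\<^esup>\<close>, the width of the cell,
  leaves at most \<open>2 L + 5\<close> sets of diameter at most \<open>2 m\<^bsup>-k\<^esup>\<close>.
\<close>

lemma coverable_slab:
  assumes L: "1 \<le> L" and T: "T \<subseteq> cell k W V"
    and close: "\<And>p p'. p \<in> T \<Longrightarrow> p' \<in> T \<Longrightarrow> \<bar>snd p - snd p'\<bar> \<le> L / real m ^ k"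
  shows "coverable T (7 * L) (7 / real m ^ k)"
proof (cases "T = {}")
  case True
  then have "coverable T 1 (7 / real m ^ k)" by (intro coverable_small) auto
  then show ?thesis using L by (elim coverable_mono) auto
next
  case False
  then obtain p0 where p0: "p0 \<in> T" by blast
  have mk: "0 < real m ^ k" using m_gt_1 by simp
  define row where "row p = \<lfloor>real m ^ k * snd p\<rfloor>" for p :: "real \<times> real"
  define I where "I = {row p0 - (\<lceil>L\<rceil> + 1)..row p0 + (\<lceil>L\<rceil> + 1)}"
  have dist_rows: "real m ^ k * \<bar>snd p - snd p'\<bar> = \<bar>real m ^ k * snd p - real m ^ k * snd p'\<bar>" for p p' :: "real \<times> real"
    by (simp add: abs_mult flip: right_diff_distrib)
  show ?thesis
  proof (rule coverableI[of I _ _ "\<lambda>i. {p \<in> T. row p = i}"])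
    show "real (card I) \<le> 7 * L" unfolding I_def using L by simp linarith
    show "T \<subseteq> (\<Union>i\<in>I. {p \<in> T. row p = i})"
    proof
      fix p assume p: "p \<in> T"
      have "real m ^ k * \<bar>snd p - snd p0\<bar> \<le> L" using close[OF p p0] mk by (simp add: field_simps)
      then have "row p \<in> I" unfolding I_def row_def dist_rows by auto linarith+
      with p show "p \<in> (\<Union>i\<in>I. {p \<in> T. row p = i})" by blast
    qed
    fix i p p' assume mem: "i \<in> I" "p \<in> {p \<in> T. row p = i}" "p' \<in> {p \<in> T. row p = i}"
    then have "real m ^ k * \<bar>snd p - snd p'\<bar> \<le> 1" unfolding dist_rows row_def by auto linarith
    then have "\<bar>snd p - snd p'\<bar> \<le> 1 / real m ^ k" using mk by (simp add: field_simps)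
    moreover have "\<bar>fst p - fst p'\<bar> \<le> 1 / real m ^ k" using cell_close(1) mem T by blast
    moreover have "dist p p' \<le> \<bar>fst p - fst p'\<bar> + \<bar>snd p - snd p'\<bar>"
      unfolding dist_prod_def dist_real_def by (rule sqrt_sum_squares_le_sum_abs[THEN order_trans]) simp
    ultimately have "dist p p' \<le> 2 / real m ^ k" by simp
    also have "\<dots> \<le> 7 / real m ^ k" using mk by (intro divide_right_mono) auto
    finally show "dist p p' \<le> 7 / real m ^ k" .
  qed (simp add: I_def)
qed

text \<open>
  A cell of level \<open>k\<close> is \<open>(m / n)\<^bsup>k\<^esup>\<close> times as high as wide, so the at most \<open>(n N)\<^bsup>k\<^esup>\<close> cells
  need \<open>O((N m)\<^bsup>k\<^esup>)\<close> sets of diameter \<open>O(m\<^bsup>-k\<^esup>)\<close>.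
\<close>

proposition star_dim_carpet_le: "star_dim (carpet m n D) \<le> ereal (1 + log (real m) (real N))"
proof -
  have "star_dim (carpet m n D) \<le> ereal (log (real m) (real N * real m ^ 1))"
  proof (rule star_dim_le_of_cells[where C = 7])
    show "coverable T (7 * L ^ 1) (7 / real m ^ k)"
      if "1 \<le> L" "T \<subseteq> carpet m n D \<inter> cell k W V"
        "\<And>p p'. p \<in> T \<Longrightarrow> p' \<in> T \<Longrightarrow> \<bar>snd p - snd p'\<bar> \<le> L / real m ^ k" for k W V T L
      using coverable_slab[of L T k W V] that by auto
    have "coverable (carpet m n D) (7 * (real k + 1) * (real N * real m ^ 1) ^ k) (7 / real m ^ k)" for k
    proof -
      \<comment> \<open>The height of a cell of level \<open>k\<close> in units of its width.\<close>
      define L where "L = (real m / real n) ^ k"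
      have L: "1 \<le> L" unfolding L_def using n_gt_1 n_less_m by (intro one_le_power) auto
      have "coverable (\<Union>c\<in>codes k. cell k (fst c) (snd c)) (real (card (codes k)) * (7 * L)) (7 / real m ^ k)"
      proof (rule coverable_UN)
        fix c
        have "1 / real n ^ k = L / real m ^ k" using m_gt_1 n_gt_1 by (simp add: L_def power_divide)
        then show "coverable (cell k (fst c) (snd c)) (7 * L) (7 / real m ^ k)"
          using cell_close(2)[of _ k "fst c" "snd c"] by (intro coverable_slab[OF L subset_refl]) metis
      qed (use codes_finite_card in blast)
      moreover have "carpet m n D \<subseteq> (\<Union>c\<in>codes k. cell k (fst c) (snd c))"
        using carpet_subset_cells[of k] by (simp add: case_prod_beta)
      moreover have "real (card (codes k)) * (7 * L) \<le> 7 * (real k + 1) * (real N * real m ^ 1) ^ k"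
      proof -
        have "real (card (codes k)) \<le> real ((n * N) ^ k)" using codes_finite_card by (intro of_nat_mono) blast
        then have "real (card (codes k)) * (7 * L) \<le> real ((n * N) ^ k) * (7 * L)"
          using L by (intro mult_right_mono) auto
        also have "\<dots> = 7 * 1 * (real N * real m ^ 1) ^ k"
          using n_gt_1 by (simp add: L_def power_divide power_mult_distrib)
        also have "\<dots> \<le> 7 * (real k + 1) * (real N * real m ^ 1) ^ k" by (intro mult_right_mono) auto
        finally show ?thesis .
      qed
      ultimately show ?thesis by (blast intro: coverable_mono)
    qed
    then show "\<exists>k\<ge>K. coverable (carpet m n D) (7 * (real k + 1) * (real N * real m ^ 1) ^ k) (7 / real m ^ k)" for K
      by blast
  qed auto
  also have "log (real m) (real N * real m ^ 1) = 1 + log (real m) (real N)"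
    using m_gt_1 N_pos by (simp add: log_mult)
  finally show ?thesis .
qed

section \<open>Lower bounds for star dimensions\<close>

definition row :: "nat set" where "row = {i. (i, j0) \<in> D}"

text \<open>
  The words of length \<open>q\<close> over the largest row, continued by the full column. These sets are finite,
  so sets built from them are closed, as minisets must be.
\<close>

definition row_words :: "nat \<Rightarrow> real set" where
  "row_words q = (\<lambda>w. expansion m (\<lambda>i. if i < q then w i else i0)) ` (\<Pi>\<^sub>E i\<in>{..<q}. row)"

lemma row_less: "row \<subseteq> {..<m}"
  unfolding row_def using digits by auto

lemma row_nonempty: "row \<noteq> {}"
  unfolding row_def using full_column[OF j0_less] by blast

lemma i0_less: "i0 < m" using full_column[OF j0_less] digits by auto

lemma finite_row_words: "finite (row_words q)"
  unfolding row_words_def using finite_row[of j0] by (intro finite_imageI finite_PiE) (auto simp: row_def)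

lemma row_words_eq:
  "row_words q = {expansion m (\<lambda>i. if i < q then w i else i0) | w. \<forall>i. w i \<in> row}" (is "_ = ?R")
proof
  show "row_words q \<subseteq> ?R"
  proof
    fix x assume "x \<in> row_words q"
    then obtain w where w: "w \<in> (\<Pi>\<^sub>E i\<in>{..<q}. row)" and x: "x = expansion m (\<lambda>i. if i < q then w i else i0)"
      unfolding row_words_def by blast
    obtain a where a: "a \<in> row" using row_nonempty by blast
    define w' where "w' i = (if i < q then w i else a)" for i
    have "x = expansion m (\<lambda>i. if i < q then w' i else i0)"
      unfolding x by (intro arg_cong[where f = "expansion m"]) (auto simp: w'_def)
    moreover have "\<forall>i. w' i \<in> row" using w a by (auto simp: w'_def PiE_iff)
    ultimately show "x \<in> ?R" by blast
  qed
  show "?R \<subseteq> row_words q"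
  proof
    fix x assume "x \<in> ?R"
    then obtain w where w: "\<forall>i. w i \<in> row" and x: "x = expansion m (\<lambda>i. if i < q then w i else i0)" by blast
    have "x = expansion m (\<lambda>i. if i < q then restrict w {..<q} i else i0)"
      unfolding x by (intro arg_cong[where f = "expansion m"]) auto
    moreover have "restrict w {..<q} \<in> (\<Pi>\<^sub>E i\<in>{..<q}. row)" using w by auto
    ultimately show "x \<in> row_words q" unfolding row_words_def by blast
  qed
qed

lemma row_words_close:
  assumes "\<forall>i. w i \<in> row"
  shows "\<bar>expansion m w - expansion m (\<lambda>i. if i < q then w i else i0)\<bar> \<le> 1 / real m ^ q"
proof (rule expansion_close_of_prefix[OF m_gt_1])
  show "w i < m" for i using assms row_less by blast
  then show "(if i < q then w i else i0) < m" for i using i0_less by simp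
qed simp

lemma row_words_bounds: "x \<in> row_words q \<Longrightarrow> 0 \<le> x \<and> x \<le> 1"
proof -
  assume "x \<in> row_words q"
  then obtain w where w: "\<forall>i. w i \<in> row" and x: "x = expansion m (\<lambda>i. if i < q then w i else i0)"
    unfolding row_words_eq by blast
  define d where "d i = (if i < q then w i else i0)" for i
  have "\<And>i. d i < m" using w row_less i0_less by (auto simp: d_def)
  moreover have "x = expansion m d" unfolding x by (intro arg_cong[where f = "expansion m"]) (auto simp: d_def)
  ultimately show ?thesis using expansion_nonneg[OF m_gt_1, of d] expansion_le_1[OF m_gt_1, of d] by simp
qed

lemma closure_digit_set_bounds: "closure (digit_set m row) \<subseteq> {0..1}"
proof (rule closure_minimal)
  show "digit_set m row \<subseteq> {0..1}"
  proof
    fix x assume "x \<in> digit_set m row"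
    then obtain w where w: "\<forall>i. w i \<in> row" and x: "x = expansion m w" unfolding digit_set_def by blast
    have "\<And>i. w i < m" using w row_less by auto
    then show "x \<in> {0..1}"
      unfolding x using expansion_nonneg[OF m_gt_1, of w] expansion_le_1[OF m_gt_1, of w] by auto
  qed
qed simp

text \<open>
  The shear \<open>(x, y) \<mapsto> (x, y + u x)\<close> covers both microsets: \<open>Y = {0}\<close> yields a segment of a line
  of slope \<open>u\<close> over the digit set, and \<open>u = 0\<close> yields the product of the digit set with \<open>Y\<close>. The
  digit set is within \<open>m\<^bsup>-q\<^esup>\<close> of \<open>row_words q\<close>, so the minisets over \<open>row_words q\<close> converge. The
  closure is taken to have a closed limit; it cannot lower the Hausdorff dimension.
\<close>

lemma microset_sheared:
  assumes Y: "compact Y" "Y \<noteq> {}" and u: "\<bar>u\<bar> \<le> 1"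
    and window: "\<And>x y. 0 \<le> x \<Longrightarrow> x \<le> 1 \<Longrightarrow> y \<in> Y \<Longrightarrow> y + u * x \<in> {-1..1}"
    and approx: "\<And>q. \<exists>a\<ge>1. \<exists>v. \<forall>x\<in>row_words q. \<forall>y\<in>Y. (x, y + u * x) \<in> (\<lambda>p. a *\<^sub>R p + v) ` X"
  shows "microset X ((\<lambda>(x, y). (x, y + u * x)) ` (closure (digit_set m row) \<times> Y))"
proof -
  define S where "S = (\<lambda>(x, y). (x, y + u * x))"
  have cont: "continuous_on T S" for T
    unfolding S_def case_prod_beta by (intro continuous_intros)
  let ?E = "digit_set m row"
  have "bounded (closure ?E)"
    using closure_digit_set_bounds bounded_closed_interval bounded_subset by blast
  then have cE: "compact (closure ?E)" by (simp add: compact_eq_bounded_closed)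
  obtain a0 where a0: "a0 \<in> row" using row_nonempty by blast
  have "expansion m (\<lambda>_. a0) \<in> ?E" using a0 by (auto simp: mem_digit_set)
  then have E_ne: "?E \<noteq> {}" by blast
  then have cE_ne: "closure ?E \<noteq> {}" by simp
  have W_ne: "row_words q \<noteq> {}" for q
    unfolding row_words_def using a0 by (simp add: PiE_eq_empty_iff row_nonempty)
  have win: "S ` (T \<times> Y) \<subseteq> unit_window" if "T \<subseteq> {0..1}" for T
    using that window unfolding S_def unit_window_def by fastforce
  have compM: "compact (S ` (closure ?E \<times> Y))"
    by (intro compact_continuous_image cont compact_Times cE Y)
  have compA: "compact (S ` (row_words q \<times> Y))" for q
    by (intro compact_continuous_image cont compact_Times finite_imp_compact finite_row_words Y)
  have mini: "miniset X (S ` (row_words q \<times> Y))" for q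
  proof -
    obtain a v where a: "1 \<le> a" "\<forall>x\<in>row_words q. \<forall>y\<in>Y. (x, y + u * x) \<in> (\<lambda>p. a *\<^sub>R p + v) ` X"
      using approx by blast
    have "S ` (row_words q \<times> Y) \<subseteq> (\<lambda>p. a *\<^sub>R p + v) ` X" using a(2) unfolding S_def by auto
    moreover have "S ` (row_words q \<times> Y) \<subseteq> unit_window" using row_words_bounds by (intro win) auto
    moreover have "closed (S ` (row_words q \<times> Y))" using compA by (rule compact_imp_closed)
    ultimately show ?thesis unfolding miniset_def using a(1) W_ne Y(2) by blast
  qed
  have S_close: "dist (S (x, y)) (S (x', y)) \<le> 4 * \<delta>" if "\<bar>x - x'\<bar> \<le> 2 * \<delta>" for x x' y \<delta> :: real
  proof -
    have "dist (S (x, y)) (S (x', y)) \<le> \<bar>x - x'\<bar> + \<bar>u * x - u * x'\<bar>"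
      unfolding S_def by (simp add: dist_prod_def dist_real_def sqrt_sum_squares_le_sum_abs[THEN order_trans])
    also have "\<bar>u * x - u * x'\<bar> = \<bar>u\<bar> * \<bar>x - x'\<bar>" by (simp add: abs_mult flip: right_diff_distrib)
    also have "\<dots> \<le> 1 * (2 * \<delta>)" using u that by (intro mult_mono) auto
    finally show ?thesis using that by simp
  qed
  define e where "e q = (1 / real m) ^ q" for q
  have e_pos: "0 < e q" for q using m_gt_1 by (simp add: e_def)
  have e_eq: "1 / real m ^ q = e q" for q by (simp add: e_def power_divide)
  have hd: "hausdorff_dist (S ` (row_words q \<times> Y)) (S ` (closure ?E \<times> Y)) \<le> 4 * e q" for q
  proof (rule hausdorff_dist_le)
    fix p assume "p \<in> S ` (row_words q \<times> Y)"
    then obtain x y where p: "p = S (x, y)" "x \<in> row_words q" "y \<in> Y" by blast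
    then obtain w where w: "\<forall>i. w i \<in> row" "x = expansion m (\<lambda>i. if i < q then w i else i0)"
      unfolding row_words_eq by blast
    have "expansion m w \<in> ?E" using w(1) by (auto simp: mem_digit_set)
    then have "expansion m w \<in> closure ?E" by (rule subsetD[OF closure_subset])
    moreover have "\<bar>x - expansion m w\<bar> \<le> e q"
      using row_words_close[OF w(1), of q] unfolding w(2) e_eq by (simp add: abs_minus_commute)
    then have "\<bar>x - expansion m w\<bar> \<le> 2 * e q" using e_pos[of q] by linarith
    then have "dist p (S (expansion m w, y)) \<le> 4 * e q" unfolding p(1) by (rule S_close)
    ultimately show "\<exists>p'\<in>S ` (closure ?E \<times> Y). dist p p' \<le> 4 * e q" using p(3) by blast
  next
    fix p assume "p \<in> S ` (closure ?E \<times> Y)"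
    then obtain x y where p: "p = S (x, y)" "x \<in> closure ?E" "y \<in> Y" by blast
    obtain x' where x': "x' \<in> ?E" "dist x' x < e q"
      using p(2) e_pos[of q] unfolding closure_approachable by blast
    then obtain w where w: "\<forall>i. w i \<in> row" "x' = expansion m w" unfolding mem_digit_set by blast
    define x'' where "x'' = expansion m (\<lambda>i. if i < q then w i else i0)"
    have "\<bar>x' - x''\<bar> \<le> e q" using row_words_close[OF w(1), of q] w(2) by (simp add: x''_def e_eq)
    then have "\<bar>x - x''\<bar> \<le> 2 * (e q)" using x'(2) unfolding dist_real_def by linarith
    then have "dist p (S (x'', y)) \<le> 4 * e q" unfolding p(1) by (rule S_close)
    moreover have "x'' \<in> row_words q"
      unfolding row_words_eq x''_def mem_Collect_eq using w(1) by (intro exI[of _ w] conjI refl)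
    ultimately show "\<exists>p'\<in>S ` (row_words q \<times> Y). dist p p' \<le> 4 * e q" using p(3) by blast
  qed (use W_ne cE_ne Y in auto)
  have "(\<lambda>q. hausdorff_dist (S ` (row_words q \<times> Y)) (S ` (closure ?E \<times> Y))) \<longlonglongrightarrow> 0"
  proof (rule tendsto_sandwich[OF always_eventually always_eventually tendsto_const])
    show "\<forall>q. 0 \<le> hausdorff_dist (S ` (row_words q \<times> Y)) (S ` (closure ?E \<times> Y))"
      using compA compM W_ne cE_ne Y(2) by (intro allI hausdorff_dist_nonneg compact_imp_bounded) auto
    show "\<forall>q. hausdorff_dist (S ` (row_words q \<times> Y)) (S ` (closure ?E \<times> Y)) \<le> 4 * (1 / real m) ^ q"
      using hd unfolding e_def by blast
    have "(\<lambda>q. 4 * (1 / real m) ^ q) \<longlonglongrightarrow> 4 * 0"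
      using m_gt_1 by (intro tendsto_mult tendsto_const LIMSEQ_realpow_zero) auto
    then show "(\<lambda>q. 4 * (1 / real m) ^ q) \<longlonglongrightarrow> 0" by simp
  qed
  moreover have "S ` (closure ?E \<times> Y) \<subseteq> unit_window" by (rule win[OF closure_digit_set_bounds])
  moreover have "closed (S ` (closure ?E \<times> Y))" using compM by (rule compact_imp_closed)
  moreover have "S ` (closure ?E \<times> Y) \<noteq> {}" using cE_ne Y(2) by simp
  ultimately have "microset X (S ` (closure ?E \<times> Y))"
    unfolding microset_def by (intro conjI exI[of _ "\<lambda>q. S ` (row_words q \<times> Y)"] allI mini)
  then show ?thesis unfolding S_def .
qed

text \<open>
  Horizontal digits \<open>i\<^sub>0\<close> are compatible with all vertical digits, and the remaining horizontal
  digits, in positions \<open>k\<close> to \<open>k + q - 1\<close>, face the vertical digit \<open>j\<^sub>0\<close>.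
\<close>

lemma carpet_point_with_row_block:
  assumes "x \<in> row_words q" and "U < n ^ k" and "0 \<le> z" and "z < 1"
  shows "((real (prefix_value m (\<lambda>_. i0) k) + x) / real m ^ k,
     (real (U * n ^ q + prefix_value n (\<lambda>_. j0) q) + z) / real n ^ (k + q)) \<in> carpet m n D"
proof -
  obtain w where w: "\<forall>i. w i \<in> row" and x: "x = expansion m (\<lambda>i. if i < q then w i else i0)"
    using assms(1) unfolding row_words_eq by blast
  obtain y where y: "\<And>i. y i < n" "\<And>i. k \<le> i \<Longrightarrow> i < k + q \<Longrightarrow> y i = j0"
    and y_eq: "expansion n y = (real (U * n ^ q + prefix_value n (\<lambda>_. j0) q) + z) / real n ^ (k + q)"
    using expansion_with_block[OF n_gt_1 j0_less assms(2-4)] by blast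
  define x' where "x' i = (if i < k then i0 else if i - k < q then w (i - k) else i0)" for i
  have "valid x' y"
    unfolding valid_def
  proof
    fix i
    show "(x' i, y i) \<in> D"
    proof (cases "k \<le> i \<and> i < k + q")
      case True
      then have "x' i = w (i - k)" "y i = j0" using y(2) by (auto simp: x'_def)
      then show ?thesis using w unfolding row_def by simp
    next
      case False
      then have "x' i = i0" by (auto simp: x'_def)
      then show ?thesis using full_column y(1) by simp
    qed
  qed
  moreover have "x' i < m" for i using w row_less i0_less by (auto simp: x'_def)
  then have "real m ^ k * expansion m x' = real (prefix_value m x' k) + expansion m (\<lambda>i. x' (k + i))"
    by (rule expansion_prefix[OF m_gt_1])
  moreover have "prefix_value m x' k = prefix_value m (\<lambda>_. i0) k"
    by (rule prefix_value_cong) (simp add: x'_def)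
  moreover have "(\<lambda>i. x' (k + i)) = (\<lambda>i. if i < q then w i else i0)" by (auto simp: x'_def)
  ultimately have "valid x' y" "expansion m x' = (real (prefix_value m (\<lambda>_. i0) k) + x) / real m ^ k"
    using x m_gt_1 by (auto simp: field_simps)
  then show ?thesis unfolding carpet_eq_valid using y_eq by (metis (mono_tags, lifting) mem_Collect_eq)
qed

lemma card_row: "card row = N" unfolding row_def N_def ..

text \<open>
  At the level \<open>k\<close> where a cell of level \<open>k + q\<close> is at least as high as a cell of level \<open>k\<close> is wide,
  magnification by \<open>m\<^bsup>k\<^esup>\<close> shows vertical segments of length at least \<open>1\<close> above every element of
  \<open>row_words q\<close>. Half of such a segment is used to stay inside half-open cylinders.
\<close>

proposition star_dim_carpet_ge: "ereal (1 + log (real m) (real N)) \<le> star_dim (carpet m n D)"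
proof -
  let ?M = "(\<lambda>(x, y). (x, y + 0 * x)) ` (closure (digit_set m row) \<times> {0..1/2::real})"
  have "microset (carpet m n D) ?M"
  proof (rule microset_sheared)
    fix q
    obtain k where "real n ^ q * real n ^ k \<le> real m ^ k" using ratio_eventually[of "real n ^ q"] by blast
    then have k: "real n ^ (k + q) \<le> real m ^ k" by (simp add: power_add mult.commute)
    define J where "J = real (prefix_value n (\<lambda>_. j0) q)"
    define B where "B = real (prefix_value m (\<lambda>_. i0) k)"
    have pos: "0 < real m ^ k" "0 < real n ^ (k + q)" using m_gt_1 n_gt_1 by auto
    have "(x, y + 0 * x) \<in> (\<lambda>p. real m ^ k *\<^sub>R p + (- B, - (real m ^ k * J / real n ^ (k + q)))) ` carpet m n D"
      if x: "x \<in> row_words q" and y: "y \<in> {0..1/2}" for x y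
    proof -
      define z where "z = y * (real n ^ (k + q) / real m ^ k)"
      have "real n ^ (k + q) / real m ^ k \<le> 1" using k pos by simp
      then have "z \<le> 1 / 2 * 1" unfolding z_def using y pos by (intro mult_mono) auto
      moreover have "0 \<le> z" unfolding z_def using y pos by auto
      ultimately have "((B + x) / real m ^ k, (J + z) / real n ^ (k + q)) \<in> carpet m n D"
        using carpet_point_with_row_block[OF x, of 0 k z] n_gt_1 by (simp add: B_def J_def)
      moreover have "(x, y + 0 * x)
          = real m ^ k *\<^sub>R ((B + x) / real m ^ k, (J + z) / real n ^ (k + q)) + (- B, - (real m ^ k * J / real n ^ (k + q)))"
        using m_gt_1 n_gt_1 by (simp add: z_def field_simps)
      ultimately show ?thesis by blast
    qed
    moreover have "1 \<le> real m ^ k" using m_gt_1 by simp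
    ultimately show "\<exists>a\<ge>1. \<exists>v. \<forall>x\<in>row_words q. \<forall>y\<in>{0..1/2}. (x, y + 0 * x) \<in> (\<lambda>p. a *\<^sub>R p + v) ` carpet m n D"
      by blast
  qed auto
  then have "hausdorff_dim ?M \<le> star_dim (carpet m n D)" unfolding star_dim_def by (intro Sup_upper) blast
  moreover have "digit_set m row \<times> {0..1/2} \<subseteq> ?M"
  proof
    fix p :: "real \<times> real" assume "p \<in> digit_set m row \<times> {0..1/2}"
    then have "p \<in> closure (digit_set m row) \<times> {0..1/2}" using closure_subset by (auto simp: mem_Times_iff)
    moreover have "p = (\<lambda>(x, y). (x, y + 0 * x)) p" by (simp add: case_prod_beta)
    ultimately show "p \<in> ?M" by blast
  qed
  then have "ereal (1 + log (real m) (real (card row))) \<le> hausdorff_dim ?M"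
    by (rule hausdorff_dim_digit_set_times_interval[OF m_gt_1 row_nonempty row_less])
  ultimately show ?thesis unfolding card_row by order
qed

lemma star_dim_carpet: "star_dim (carpet m n D) = ereal (1 + log (real m) (real N))"
  using star_dim_carpet_le star_dim_carpet_ge by (rule antisym)

text \<open>
  The abscissa with all digits \<open>i\<^sub>0\<close>. Lines are located by their height above this point.
\<close>

definition column_point :: real where "column_point = expansion m (\<lambda>_. i0)"

text \<open>
  All abscissae with horizontal prefix \<open>i\<^sub>0 \<dots> i\<^sub>0\<close> of length \<open>k\<close> are within \<open>m\<^bsup>-k\<^esup>\<close> of
  \<open>column_point\<close>, so the line varies by at most \<open>\<bar>u\<bar> m\<^bsup>-k\<^esup>\<close> there. Hypothesis \<open>block\<close> keeps it
  inside a strip of height \<open>n\<^bsup>-(k+q)\<^esup>\<close> whose address ends with \<open>q\<close> copies of \<open>j\<^sub>0\<close>, and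
  \<open>carpet_point_with_row_block\<close> puts the points of the line over \<open>row_words q\<close>
  into the carpet.
\<close>

lemma star_dim_slice_ge:
  assumes u: "\<bar>u\<bar> \<le> 1"
    and block: "\<And>q. \<exists>k U. U < n ^ k \<and>
      \<bar>u * column_point + t - (real (U * n ^ q + prefix_value n (\<lambda>_. j0) q) + 1 / 2) / real n ^ (k + q)\<bar>
      < 1 / (2 * real n ^ (k + q)) - \<bar>u\<bar> / real m ^ k"
  shows "ereal (log (real m) (real N)) \<le> star_dim (planar_line u t \<inter> carpet m n D)"
proof -
  let ?X = "planar_line u t \<inter> carpet m n D"
  let ?M = "(\<lambda>(x, y). (x, y + u * x)) ` (closure (digit_set m row) \<times> {0::real})"
  have "microset ?X ?M"
  proof (rule microset_sheared[OF _ _ u])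
    fix q
    define y0 where "y0 = u * column_point + t"
    obtain k U where U: "U < n ^ k" and near:
      "\<bar>y0 - (real (U * n ^ q + prefix_value n (\<lambda>_. j0) q) + 1 / 2) / real n ^ (k + q)\<bar>
      < 1 / (2 * real n ^ (k + q)) - \<bar>u\<bar> / real m ^ k"
      using block[of q] unfolding y0_def by blast
    define V where "V = real (U * n ^ q + prefix_value n (\<lambda>_. j0) q)"
    define B where "B = real (prefix_value m (\<lambda>_. i0) k)"
    have pos: "0 < real m ^ k" "0 < real n ^ (k + q)" using m_gt_1 n_gt_1 by auto
    have cp: "column_point = (B + column_point) / real m ^ k"
      using expansion_prefix[OF m_gt_1, of "\<lambda>_. i0" k] i0_less pos by (simp add: column_point_def B_def field_simps)
    have cp01: "0 \<le> column_point" "column_point \<le> 1"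
      unfolding column_point_def using expansion_nonneg[OF m_gt_1] expansion_le_1[OF m_gt_1] i0_less by auto
    have "(x, y + u * x) \<in> (\<lambda>p. real m ^ k *\<^sub>R p + (- B, u * column_point - real m ^ k * y0)) ` ?X"
      if x: "x \<in> row_words q" and y: "y \<in> {0}" for x y
    proof -
      define X' where "X' = (B + x) / real m ^ k"
      define Y' where "Y' = u * X' + t"
      have X_cp: "X' - column_point = (x - column_point) / real m ^ k"
        unfolding X'_def by (subst (1) cp) (simp add: diff_divide_distrib[symmetric])
      have Y'_eq: "Y' - y0 = u * (x - column_point) / real m ^ k"
        using X_cp by (simp add: Y'_def y0_def flip: right_diff_distrib times_divide_eq_right)
      have "\<bar>x - column_point\<bar> \<le> 1" using row_words_bounds[OF x] cp01 by linarith
      then have "\<bar>u\<bar> * \<bar>x - column_point\<bar> \<le> \<bar>u\<bar> * 1" by (intro mult_left_mono) auto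
      then have "\<bar>u * (x - column_point) / real m ^ k\<bar> \<le> \<bar>u\<bar> / real m ^ k"
        using pos by (simp add: abs_mult divide_right_mono)
      then have "\<bar>Y' - y0\<bar> \<le> \<bar>u\<bar> / real m ^ k" unfolding Y'_eq .
      then have "\<bar>Y' - (V + 1 / 2) / real n ^ (k + q)\<bar> < 1 / (2 * real n ^ (k + q))"
        using near unfolding V_def by linarith
      moreover define z where "z = real n ^ (k + q) * Y' - V"
      then have "Y' = (V + z) / real n ^ (k + q)" using pos by simp
      ultimately have "\<bar>(V + z) / real n ^ (k + q) - (V + 1 / 2) / real n ^ (k + q)\<bar> < 1 / (2 * real n ^ (k + q))"
        by simp
      then have "\<bar>(z - 1 / 2) / real n ^ (k + q)\<bar> < 1 / 2 / real n ^ (k + q)"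
        by (simp flip: diff_divide_distrib)
      then have "\<bar>z - 1 / 2\<bar> / real n ^ (k + q) < 1 / 2 / real n ^ (k + q)"
        using pos by (simp only: abs_divide abs_of_pos)
      then have "\<bar>z - 1 / 2\<bar> < 1 / 2" using pos(2) unfolding divide_less_cancel by linarith
      then have z: "0 \<le> z" "z < 1" by linarith+
      have "(X', Y') \<in> carpet m n D"
        unfolding \<open>Y' = (V + z) / real n ^ (k + q)\<close> X'_def V_def B_def
        by (rule carpet_point_with_row_block[OF x U z])
      then have "(X', Y') \<in> ?X" by (simp add: planar_line_def Y'_def)
      moreover have "(x, y + u * x) = real m ^ k *\<^sub>R (X', Y') + (- B, u * column_point - real m ^ k * y0)"
      proof -
        have "real m ^ k * (Y' - y0) = u * (x - column_point)" using Y'_eq pos by simp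
        moreover have "real m ^ k * X' = B + x" using pos by (simp add: X'_def)
        ultimately show ?thesis using y by (simp add: algebra_simps)
      qed
      ultimately show ?thesis by blast
    qed
    moreover have "1 \<le> real m ^ k" using m_gt_1 by simp
    ultimately show "\<exists>a\<ge>1. \<exists>v. \<forall>x\<in>row_words q. \<forall>y\<in>{0}. (x, y + u * x) \<in> (\<lambda>p. a *\<^sub>R p + v) ` ?X"
      by blast
  next
    fix x y :: real assume "0 \<le> x" "x \<le> 1" "y \<in> {0}"
    then have "\<bar>u * x\<bar> \<le> 1 * 1" unfolding abs_mult using u by (intro mult_mono) auto
    then show "y + u * x \<in> {-1..1}" using \<open>y \<in> {0}\<close> by auto
  qed auto
  then have "hausdorff_dim ?M \<le> star_dim ?X" unfolding star_dim_def by (intro Sup_upper) blast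
  moreover have "(x, u * x) \<in> ?M" if "x \<in> digit_set m row" for x
    using that closure_subset by (force simp: image_iff)
  then have "ereal (log (real m) (real (card row))) \<le> hausdorff_dim ?M"
    by (rule hausdorff_dim_digit_set_graph[OF m_gt_1 row_nonempty row_less])
  ultimately show ?thesis unfolding card_row by order
qed

end

section \<open>Choosing the intercept\<close>

text \<open>
  Points outside a finite union of closed intervals stay outside under small perturbations, so the
  number of intervals met is upper semicontinuous.
\<close>

lemma open_card_close_le:
  fixes f :: "'c \<Rightarrow> real"
  assumes "finite I"
  shows "open {y. card {c \<in> I. \<bar>y - f c\<bar> \<le> \<rho>} \<le> B}"
proof (subst open_subopen, rule ballI)
  fix y assume "y \<in> {y. card {c \<in> I. \<bar>y - f c\<bar> \<le> \<rho>} \<le> B}"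
  then have y: "card {c \<in> I. \<bar>y - f c\<bar> \<le> \<rho>} \<le> B" by simp
  define U where "U = (\<Inter>c\<in>{c \<in> I. \<rho> < \<bar>y - f c\<bar>}. {y'. \<rho> < \<bar>y' - f c\<bar>})"
  have "open U"
    unfolding U_def using assms by (intro open_INT ballI open_Collect_less continuous_intros) auto
  moreover have "y \<in> U" unfolding U_def by blast
  moreover have "U \<subseteq> {y. card {c \<in> I. \<bar>y - f c\<bar> \<le> \<rho>} \<le> B}"
  proof
    fix y' assume y': "y' \<in> U"
    have "{c \<in> I. \<bar>y' - f c\<bar> \<le> \<rho>} \<subseteq> {c \<in> I. \<bar>y - f c\<bar> \<le> \<rho>}"
    proof
      fix c assume c: "c \<in> {c \<in> I. \<bar>y' - f c\<bar> \<le> \<rho>}"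
      then have "\<not> \<rho> < \<bar>y - f c\<bar>" using y' unfolding U_def by auto
      with c show "c \<in> {c \<in> I. \<bar>y - f c\<bar> \<le> \<rho>}" by simp
    qed
    then have "card {c \<in> I. \<bar>y' - f c\<bar> \<le> \<rho>} \<le> card {c \<in> I. \<bar>y - f c\<bar> \<le> \<rho>}"
      using assms by (intro card_mono) auto
    with y show "y' \<in> {y. card {c \<in> I. \<bar>y - f c\<bar> \<le> \<rho>} \<le> B}" by simp
  qed
  ultimately show "\<exists>T. open T \<and> y \<in> T \<and> T \<subseteq> {y. card {c \<in> I. \<bar>y - f c\<bar> \<le> \<rho>} \<le> B}" by blast
qed

text \<open>
  Averaging: the integral of the number of intervals met is at most the total length of the
  intervals.
\<close>

lemma exists_few_close:
  fixes f :: "'c \<Rightarrow> real"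
  assumes fin: "finite I" and "\<alpha> \<le> \<beta>" and "0 \<le> \<rho>"
    and few: "real (card I) * (2 * \<rho>) < real B * (\<beta> - \<alpha>)"
  shows "\<exists>y\<in>{\<alpha><..<\<beta>}. card {c \<in> I. \<bar>y - f c\<bar> \<le> \<rho>} \<le> B"
proof (rule ccontr)
  assume "\<not> ?thesis"
  then have many: "B \<le> card {c \<in> I. \<bar>y - f c\<bar> \<le> \<rho>}" if "y \<in> {\<alpha><..<\<beta>}" for y
    using that by (meson nle_le)
  let ?J = "\<lambda>c. {f c - \<rho>..f c + \<rho>}"
  have "ennreal (real B * (\<beta> - \<alpha>)) = (\<integral>\<^sup>+y. ennreal (real B) * indicator {\<alpha><..<\<beta>} y \<partial>lborel)"
    using assms(2) by (subst nn_integral_cmult_indicator) (auto simp: ennreal_mult)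
  also have "\<dots> \<le> (\<integral>\<^sup>+y. (\<Sum>c\<in>I. indicator (?J c) y) \<partial>lborel)"
  proof (rule nn_integral_mono)
    fix y
    have "(\<Sum>c\<in>I. indicator (?J c) y :: ennreal) = (\<Sum>c\<in>{c \<in> I. \<bar>y - f c\<bar> \<le> \<rho>}. 1)"
      unfolding sum.inter_filter[OF fin] by (intro sum.cong refl) (auto simp: indicator_def)
    also have "\<dots> = ennreal (real (card {c \<in> I. \<bar>y - f c\<bar> \<le> \<rho>}))" by (simp add: ennreal_of_nat_eq_real_of_nat)
    finally have eq: "(\<Sum>c\<in>I. indicator (?J c) y :: ennreal) = ennreal (real (card {c \<in> I. \<bar>y - f c\<bar> \<le> \<rho>}))" .
    show "ennreal (real B) * indicator {\<alpha><..<\<beta>} y \<le> (\<Sum>c\<in>I. indicator (?J c) y)"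
      unfolding eq using many[of y] by (cases "y \<in> {\<alpha><..<\<beta>}") (auto intro!: ennreal_leI)
  qed
  also have "\<dots> = (\<Sum>c\<in>I. \<integral>\<^sup>+y. indicator (?J c) y \<partial>lborel)" by (intro nn_integral_sum) simp
  also have "\<dots> = (\<Sum>c\<in>I. ennreal (2 * \<rho>))"
    using assms(3) by (intro sum.cong refl) simp
  also have "\<dots> = ennreal (real (card I) * (2 * \<rho>))"
    using assms(3) by (subst ennreal_mult) (auto simp: ennreal_of_nat_eq_real_of_nat)
  finally have "real B * (\<beta> - \<alpha>) \<le> real (card I) * (2 * \<rho>)"
    using assms(3) by (subst (asm) ennreal_le_iff) auto
  with few show False by linarith
qed

text \<open>
  Density is only tested on intervals inside \<open>[0, 1]\<close>, because the strips used below exist only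
  at heights in \<open>[0, 1]\<close>.
\<close>

lemma Baire_unit_interval:
  fixes G :: "nat \<Rightarrow> real set"
  assumes "\<And>i. open (G i)"
    and dense: "\<And>i \<alpha> \<beta>. 0 \<le> \<alpha> \<Longrightarrow> \<alpha> < \<beta> \<Longrightarrow> \<beta> \<le> 1 \<Longrightarrow> G i \<inter> {\<alpha><..<\<beta>} \<noteq> {}"
  shows "\<exists>y. \<forall>i. y \<in> G i"
proof -
  have "{0..1} \<subseteq> closure (\<Inter>(range (\<lambda>i. {0..1} \<inter> G i)))"
  proof (rule Baire)
    fix T assume "T \<in> range (\<lambda>i. {0..1} \<inter> G i)"
    then obtain i where T: "T = {0..1} \<inter> G i" by blast
    have "{0..1} \<subseteq> closure T"
    proof
      fix x :: real assume x: "x \<in> {0..1}"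
      show "x \<in> closure T"
        unfolding closure_approachable
      proof (intro allI impI)
        fix e :: real assume e: "0 < e"
        have "G i \<inter> {max 0 (x - e)<..<min 1 (x + e)} \<noteq> {}" using e x by (intro dense) auto
        then obtain y where y: "y \<in> G i" "y \<in> {max 0 (x - e)<..<min 1 (x + e)}" by blast
        then show "\<exists>y\<in>T. dist y x < e"
          unfolding T dist_real_def by (intro bexI[of _ y]) (auto simp: abs_less_iff)
      qed
    qed
    then show "openin (top_of_set {0..1}) T \<and> {0..1} \<subseteq> closure T"
      unfolding T using assms(1) by (auto intro: openin_open_Int)
  qed auto
  then have "closure (\<Inter>(range (\<lambda>i. {0..1} \<inter> G i))) \<noteq> {}" by force
  then show ?thesis by auto
qed

lemma dist_on_line:
  assumes "p \<in> planar_line u t" "p' \<in> planar_line u t"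
  shows "dist p p' \<le> (1 + \<bar>u\<bar>) * \<bar>fst p - fst p'\<bar>"
proof -
  have "dist p p' \<le> \<bar>fst p - fst p'\<bar> + \<bar>snd p - snd p'\<bar>"
    unfolding dist_prod_def dist_real_def by (rule sqrt_sum_squares_le_sum_abs[THEN order_trans]) simp
  also have "snd p - snd p' = u * (fst p - fst p')"
    using assms unfolding planar_line_def by (auto simp: algebra_simps)
  finally show ?thesis by (simp add: abs_mult distrib_right)
qed

context full_column_carpet
begin

text \<open>
  Both conditions define sequences of open dense sets. The first one is dense by averaging, since
  \<open>(n N)\<^bsup>k\<^esup>\<close> intervals of radius \<open>\<rho> n\<^bsup>-k\<^esup>\<close> have average multiplicity \<open>O(N\<^bsup>k\<^esup>)\<close>, which is
  eventually below \<open>(k + 1) N\<^bsup>k\<^esup>\<close>. For the second one, every interval contains some \<open>n\<close>-adic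
  interval of a large level \<open>k\<close>, and the middle of its subinterval with address \<open>j\<^sub>0 \<dots> j\<^sub>0\<close> is at
  distance \<open>n\<^bsup>-(k+q)\<^esup> / 2 > \<bar>u\<bar> m\<^bsup>-k\<^esup>\<close> from the boundary.
\<close>

lemma exists_height:
  fixes f :: "nat \<Rightarrow> nat \<times> nat \<Rightarrow> real" and \<rho> u :: real
  assumes "0 \<le> \<rho>"
  obtains y where "\<And>K. \<exists>k\<ge>K. card {c \<in> codes k. \<bar>y - f k c\<bar> \<le> \<rho> / real n ^ k} \<le> (k + 1) * N ^ k"
    and "\<And>q. \<exists>k U. U < n ^ k \<and>
      \<bar>y - (real (U * n ^ q + prefix_value n (\<lambda>_. j0) q) + 1 / 2) / real n ^ (k + q)\<bar>
      < 1 / (2 * real n ^ (k + q)) - \<bar>u\<bar> / real m ^ k"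
proof -
  define few where "few K = (\<Union>k\<in>{K..}. {y. card {c \<in> codes k. \<bar>y - f k c\<bar> \<le> \<rho> / real n ^ k} \<le> (k + 1) * N ^ k})" for K
  define mid where "mid k q U = (real (U * n ^ q + prefix_value n (\<lambda>_. j0) q) + 1 / 2) / real n ^ (k + q)" for k q U
  define block where "block q = (\<Union>(k, U)\<in>{(k, U). U < n ^ k}.
      {y. \<bar>y - mid k q U\<bar> < 1 / (2 * real n ^ (k + q)) - \<bar>u\<bar> / real m ^ k})" for q
  define G where "G i = few i \<inter> block i" for i
  have few_open: "open (few K)" for K
    unfolding few_def using codes_finite_card by (intro open_UN ballI open_card_close_le) blast
  have block_open: "open (block q)" for q
    unfolding block_def by (intro open_UN ballI) (auto intro!: open_Collect_less continuous_intros)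
  have few_dense: "few K \<inter> {\<alpha><..<\<beta>} \<noteq> {}" if "\<alpha> < \<beta>" for K \<alpha> \<beta>
  proof -
    obtain k where k: "max (real K) (2 * \<rho> / (\<beta> - \<alpha>)) < real k" using reals_Archimedean2 by blast
    have nk: "0 < real n ^ k" using n_gt_1 by simp
    have "2 * \<rho> < real k * (\<beta> - \<alpha>)" using k that by (simp add: field_simps)
    then have *: "2 * \<rho> < real (k + 1) * (\<beta> - \<alpha>)" using that by (simp add: distrib_right)
    have "real (card (codes k)) \<le> real ((n * N) ^ k)" using codes_finite_card by (intro of_nat_mono) blast
    then have "real (card (codes k)) * (2 * (\<rho> / real n ^ k)) \<le> real ((n * N) ^ k) * (2 * (\<rho> / real n ^ k))"
      using assms by (intro mult_right_mono) auto
    also have "\<dots> = real (N ^ k) * (2 * \<rho>)" using n_gt_1 by (simp add: power_mult_distrib)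
    also have "\<dots> < real (N ^ k) * (real (k + 1) * (\<beta> - \<alpha>))"
      using * N_pos by (intro mult_strict_left_mono) auto
    also have "\<dots> = real ((k + 1) * N ^ k) * (\<beta> - \<alpha>)" by (simp add: algebra_simps)
    finally have "\<exists>y\<in>{\<alpha><..<\<beta>}. card {c \<in> codes k. \<bar>y - f k c\<bar> \<le> \<rho> / real n ^ k} \<le> (k + 1) * N ^ k"
      using that assms nk codes_finite_card by (intro exists_few_close) auto
    then show ?thesis using k unfolding few_def by force
  qed
  have block_dense: "block q \<inter> {\<alpha><..<\<beta>} \<noteq> {}" if ab: "0 \<le> \<alpha>" "\<alpha> < \<beta>" "\<beta> \<le> 1" for q \<alpha> \<beta>
  proof -
    obtain K where K: "\<And>k. K \<le> k \<Longrightarrow> (2 * \<bar>u\<bar> * real n ^ q + 1) * real n ^ k \<le> real m ^ k"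
      using ratio_eventually by blast
    obtain j where j: "2 / (\<beta> - \<alpha>) < real n ^ j" using real_arch_pow[of "real n"] n_gt_1 by auto
    define k where "k = max K j"
    have "real n ^ j \<le> real n ^ k" using n_gt_1 by (intro power_increasing) (auto simp: k_def)
    then have nk: "2 / (\<beta> - \<alpha>) < real n ^ k" using j by linarith
    then have nk2: "2 < real n ^ k * (\<beta> - \<alpha>)" using ab by (simp add: field_simps)
    have pos: "0 < real n ^ k" "0 < real n ^ q" "0 < real m ^ k" using n_gt_1 m_gt_1 by auto
    define U where "U = nat (\<lfloor>real n ^ k * \<alpha>\<rfloor> + 1)"
    have "0 \<le> real n ^ k * \<alpha>" using ab pos by simp
    then have U: "real n ^ k * \<alpha> < real U" "real U \<le> real n ^ k * \<alpha> + 1" unfolding U_def by linarith+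
    have "real n ^ k * \<beta> \<le> real n ^ k * 1" using ab pos by (intro mult_left_mono) auto
    then have "real U < real n ^ k" using U nk2 unfolding right_diff_distrib by linarith
    then have Un: "U < n ^ k" by (metis of_nat_less_iff of_nat_power)
    define J where "J = prefix_value n (\<lambda>_. j0) q"
    have "J < n ^ q" unfolding J_def using j0_less by (intro prefix_value_less)
    then have "real (J + 1) \<le> real (n ^ q)" by (intro of_nat_mono) simp
    then have J: "0 \<le> real J" "real J + 1 \<le> real n ^ q" by simp_all
    have mid: "real n ^ k * mid k q U = real U + (real J + 1 / 2) / real n ^ q"
      using n_gt_1 by (simp add: mid_def J_def power_add field_simps)
    have "0 < (real J + 1 / 2) / real n ^ q" "(real J + 1 / 2) / real n ^ q < 1"
      using J pos by auto
    then have "real n ^ k * \<alpha> < real n ^ k * mid k q U" "real n ^ k * mid k q U < real n ^ k * \<beta>"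
      using mid U nk2 unfolding right_diff_distrib by linarith+
    then have "mid k q U \<in> {\<alpha><..<\<beta>}" using pos by simp
    moreover have "mid k q U \<in> block q"
    proof -
      have "(2 * \<bar>u\<bar> * real n ^ q + 1) * real n ^ k \<le> real m ^ k" using K by (simp add: k_def)
      then have "2 * \<bar>u\<bar> * real n ^ q * real n ^ k < real m ^ k" using pos unfolding distrib_right by linarith
      then have "\<bar>u\<bar> / real m ^ k < 1 / (2 * real n ^ (k + q))"
        using m_gt_1 n_gt_1 by (simp add: power_add field_simps)
      then have "mid k q U \<in> {y. \<bar>y - mid k q U\<bar> < 1 / (2 * real n ^ (k + q)) - \<bar>u\<bar> / real m ^ k}" by simp
      then show ?thesis unfolding block_def using Un by blast
    qed
    ultimately show ?thesis by blast
  qed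
  have "\<exists>y. \<forall>i. y \<in> G i"
  proof (rule Baire_unit_interval)
    show "open (G i)" for i unfolding G_def by (intro open_Int few_open block_open)
    show "G i \<inter> {\<alpha><..<\<beta>} \<noteq> {}" if ab: "0 \<le> \<alpha>" "\<alpha> < \<beta>" "\<beta> \<le> 1" for i \<alpha> \<beta>
    proof -
      obtain y where y: "y \<in> block i" "y \<in> {\<alpha><..<\<beta>}" using block_dense[OF ab] by blast
      have "open (block i \<inter> {\<alpha><..<\<beta>})" using block_open by (intro open_Int) auto
      then obtain e where e: "0 < e" "ball y e \<subseteq> block i \<inter> {\<alpha><..<\<beta>}"
        using y unfolding open_contains_ball by blast
      have "few i \<inter> {y - e<..<y + e} \<noteq> {}" using e(1) by (intro few_dense) simp
      then show ?thesis using e(2) unfolding G_def ball_eq_greaterThanLessThan by blast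
    qed
  qed
  then obtain y where y: "\<And>i. y \<in> few i" "\<And>i. y \<in> block i" unfolding G_def by blast
  show ?thesis
  proof (rule that)
    show "\<exists>k\<ge>K. card {c \<in> codes k. \<bar>y - f k c\<bar> \<le> \<rho> / real n ^ k} \<le> (k + 1) * N ^ k" for K
      using y(1)[of K] unfolding few_def by auto
    show "\<exists>k U. U < n ^ k \<and>
      \<bar>y - (real (U * n ^ q + prefix_value n (\<lambda>_. j0) q) + 1 / 2) / real n ^ (k + q)\<bar>
      < 1 / (2 * real n ^ (k + q)) - \<bar>u\<bar> / real m ^ k" for q
      using y(2)[of q] unfolding block_def mid_def by blast
  qed
qed

text \<open>
  If the line meets the cell \<open>(W, V)\<close> of level \<open>k\<close>, then its height above \<open>column_point\<close> is within
  \<open>(1 + \<bar>u\<bar>) n\<^bsup>-k\<^esup>\<close> of the height of the parallel line through the lower left corner of the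
  cell. So the hypothesis bounds the number of cells met, and each of them contains a single piece of
  the line of diameter \<open>O(m\<^bsup>-k\<^esup>)\<close>.
\<close>

lemma star_dim_slice_le:
  assumes few: "\<And>K. \<exists>k\<ge>K. card {c \<in> codes k.
      \<bar>u * column_point + t - (real (snd c) / real n ^ k - u * (real (fst c) / real m ^ k - column_point))\<bar>
      \<le> (1 + \<bar>u\<bar>) / real n ^ k} \<le> (k + 1) * N ^ k"
  shows "star_dim (planar_line u t \<inter> carpet m n D) \<le> ereal (log (real m) (real N))"
proof -
  let ?X = "planar_line u t \<inter> carpet m n D"
  define C where "C = 1 + \<bar>u\<bar>"
  have one_piece: "coverable T 1 (C / real m ^ k)" if T: "T \<subseteq> ?X \<inter> cell k W V" for T k W V
  proof (rule coverable_small)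
    fix p p' assume p: "p \<in> T" "p' \<in> T"
    have "dist p p' \<le> C * \<bar>fst p - fst p'\<bar>" unfolding C_def using p T by (intro dist_on_line) auto
    also have "\<dots> \<le> C * (1 / real m ^ k)"
      using p T cell_close(1)[of p k W V p'] unfolding C_def by (intro mult_left_mono) auto
    finally show "dist p p' \<le> C / real m ^ k" by simp
  qed
  have "star_dim ?X \<le> ereal (log (real m) (real N * real m ^ 0))"
  proof (rule star_dim_le_of_cells[where C = C])
    show C1: "1 \<le> C" by (simp add: C_def)
    show "coverable T (C * L ^ 0) (C / real m ^ k)" if "T \<subseteq> ?X \<inter> cell k W V" for k W V T and L :: real
      using one_piece[OF that] C1 by (auto intro: coverable_mono)
    show "\<exists>k\<ge>K. coverable ?X (C * (real k + 1) * (real N * real m ^ 0) ^ k) (C / real m ^ k)" for K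
    proof -
      define hit where "hit k = {c \<in> codes k.
        \<bar>u * column_point + t - (real (snd c) / real n ^ k - u * (real (fst c) / real m ^ k - column_point))\<bar>
        \<le> (1 + \<bar>u\<bar>) / real n ^ k}" for k
      obtain k where k: "K \<le> k" "card (hit k) \<le> (k + 1) * N ^ k" using few[of K] unfolding hit_def by blast
      have "finite (hit k)" unfolding hit_def using codes_finite_card by simp
      then have "coverable (\<Union>c\<in>hit k. ?X \<inter> cell k (fst c) (snd c)) (real (card (hit k)) * 1) (C / real m ^ k)"
        by (rule coverable_UN) (rule one_piece, blast)
      moreover have "?X \<subseteq> (\<Union>c\<in>hit k. ?X \<inter> cell k (fst c) (snd c))"
      proof
        fix p assume p: "p \<in> ?X"
        then obtain c where c: "c \<in> codes k" "p \<in> cell k (fst c) (snd c)"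
          using carpet_subset_cells[of k] by force
        note b = cell_bounds[OF c(2)]
        have "snd p = u * fst p + t" using p unfolding planar_line_def by auto
        then have "u * column_point + t - (real (snd c) / real n ^ k - u * (real (fst c) / real m ^ k - column_point))
            = (snd p - real (snd c) / real n ^ k) - u * (fst p - real (fst c) / real m ^ k)"
          by (simp add: algebra_simps)
        also have "\<bar>\<dots>\<bar> \<le> \<bar>snd p - real (snd c) / real n ^ k\<bar> + \<bar>u\<bar> * \<bar>fst p - real (fst c) / real m ^ k\<bar>"
          unfolding abs_mult[symmetric] by (rule abs_triangle_ineq4)
        also have "\<dots> \<le> 1 / real n ^ k + \<bar>u\<bar> * (1 / real n ^ k)"
        proof (intro add_mono mult_left_mono)
          show "\<bar>snd p - real (snd c) / real n ^ k\<bar> \<le> 1 / real n ^ k" using b(3,4) by linarith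
          have "1 / real m ^ k \<le> 1 / real n ^ k"
            using n_gt_1 n_less_m by (intro divide_left_mono power_mono) auto
          then show "\<bar>fst p - real (fst c) / real m ^ k\<bar> \<le> 1 / real n ^ k" using b(1,2) by linarith
        qed simp
        also have "\<dots> = (1 + \<bar>u\<bar>) / real n ^ k" by (simp add: add_divide_distrib)
        finally have "c \<in> hit k" unfolding hit_def using c(1) by simp
        with c(2) p show "p \<in> (\<Union>c\<in>hit k. ?X \<inter> cell k (fst c) (snd c))" by blast
      qed
      moreover have "real (card (hit k)) * 1 \<le> C * (real k + 1) * (real N * real m ^ 0) ^ k"
      proof -
        have "real (card (hit k)) \<le> real ((k + 1) * N ^ k)" using k(2) by (rule of_nat_mono)
        also have "\<dots> = 1 * ((real k + 1) * real N ^ k)" by (simp add: algebra_simps)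
        also have "\<dots> \<le> C * ((real k + 1) * real N ^ k)" using C1 by (intro mult_right_mono) auto
        finally show ?thesis by (simp add: mult.assoc)
      qed
      ultimately show ?thesis using k(1) by (blast intro: coverable_mono)
    qed
  qed auto
  then show ?thesis by simp
qed

proposition exists_slice:
  assumes "\<bar>u\<bar> \<le> 1"
  shows "\<exists>t. star_dim (planar_line u t \<inter> carpet m n D) = star_dim (carpet m n D) - 1"
proof -
  obtain y where few: "\<And>K. \<exists>k\<ge>K. card {c \<in> codes k.
      \<bar>y - (real (snd c) / real n ^ k - u * (real (fst c) / real m ^ k - column_point))\<bar>
      \<le> (1 + \<bar>u\<bar>) / real n ^ k} \<le> (k + 1) * N ^ k"
    and block: "\<And>q. \<exists>k U. U < n ^ k \<and>
      \<bar>y - (real (U * n ^ q + prefix_value n (\<lambda>_. j0) q) + 1 / 2) / real n ^ (k + q)\<bar>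
      < 1 / (2 * real n ^ (k + q)) - \<bar>u\<bar> / real m ^ k"
    using exists_height[of "1 + \<bar>u\<bar>"
        "\<lambda>k c. real (snd c) / real n ^ k - u * (real (fst c) / real m ^ k - column_point)" u] by auto
  define t where "t = y - u * column_point"
  have y: "y = u * column_point + t" by (simp add: t_def)
  have "star_dim (planar_line u t \<inter> carpet m n D) = ereal (log (real m) (real N))"
    using star_dim_slice_le[OF few[unfolded y]] star_dim_slice_ge[OF assms block[unfolded y]] by (rule antisym)
  also have "\<dots> = star_dim (carpet m n D) - 1" unfolding star_dim_carpet by (simp add: one_ereal_def)
  finally show ?thesis by blast
qed

end

theorem theorem1p1:
  fixes m n :: nat and D :: "(nat \<times> nat) set"
  assumes "1 < n" and "n < m"
    and "D \<subseteq> {0..<m} \<times> {0..<n}"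
    and "\<exists>i0\<in>{0..<m}. {j \<in> {0..<n}. (i0, j) \<in> D} = {0..<n}"
  shows "\<exists>r::real. r > 0 \<and> (\<forall>u\<in>{-r<..<r}. \<exists>t::real.
           star_dim (planar_line u t \<inter> carpet m n D) = star_dim (carpet m n D) - 1)"
proof -
  obtain i0 where i0: "{j \<in> {0..<n}. (i0, j) \<in> D} = {0..<n}" using assms(4) by blast
  let ?card = "\<lambda>j. card {i. (i, j) \<in> D}"
  have "finite (?card ` {..<n})" "?card ` {..<n} \<noteq> {}" using assms(1) by auto
  then have "Max (?card ` {..<n}) \<in> ?card ` {..<n}" by (rule Max_in)
  then obtain j0 where j0: "j0 < n" "?card j0 = Max (?card ` {..<n})" by auto
  interpret full_column_carpet m n D i0 j0
  proof
    show "?card j \<le> ?card j0" for j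
    proof (cases "j < n")
      case True
      then show ?thesis unfolding j0(2) by (intro Max_ge) auto
    next
      case False
      then have "{i. (i, j) \<in> D} = {}" using assms(3) by auto
      then show ?thesis by simp
    qed
    show "(i0, j) \<in> D" if "j < n" for j using i0 that by (metis (no_types, lifting) atLeastLessThan_iff mem_Collect_eq zero_le)
  qed (use assms j0 in auto)
  have "\<exists>t. star_dim (planar_line u t \<inter> carpet m n D) = star_dim (carpet m n D) - 1"
    if "u \<in> {-1<..<1}" for u
    using that by (intro exists_slice) auto
  \<comment> \<open>Slopes below \<open>1\<close> keep the limit microset of the slice inside the window.\<close>
  then show ?thesis by (intro exI[of _ 1]) auto
qed

end
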